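(* Let $X$ be a Hilbert space, $(\mathcal P,d_1)$ and $(\mathcal Q,d_2)$ metric spaces, $f\colon X\times\mathcal P\times\mathcal Q\to X$ a mapping, $g\colon X\times\mathcal P\to\overline{\mathbb R}$ a lower semicontinuous function, and let $\bar v\in f(\bar x,\bar p,\bar q)+\partial_xg(\bar x,\bar p)$, $\hat v:=\bar v-f(\bar x,\bar p,\bar q)\in\partial_xg(\bar x,\bar p)$. Assume that $g$ satisfies (A2) and (A3) (see context) and let $\mathcal R$ be the threshold of prox-regularity of $g$ at $(\bar x,\bar p)$ for $\hat v$. Define the number $$\tau:=\lim_{\eta\downarrow0}\Big[\inf\Big\{\frac{\langle z,w\rangle}{\|w\|^2}\ \Big|\ z\in(\hat D^*\partial g_p)(x,v)(w),\ (x,p,v)\in\operatorname{gph}\partial_xg\cap\mathbb B_\eta(\bar x,\bar p,\hat v),\ w\ne0\Big\}\Big].$$ Then the following assertions hold: (i) The number $\tau$ is finite. (ii) The threshold of prox-regularity of $g$ at $(\bar x,\bar p)$ for $\hat v$ is computed by $\mathcal R=\max\{0,-\tau\}$.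
   Context: Notation. $X$ is a real Hilbert space identified with its dual, $\overline{\mathbb R}=(-\infty,\infty]$, $\mathbb B$ is a closed unit ball, $\mathbb B_\eta(\cdot)$ is a closed ball of radius $\eta$ (in product spaces: product of balls), $g_p:=g(\cdot,p)$. Generalized differentiation. For $\varphi\colon X\to\overline{\mathbb R}$ and $\varphi(\bar x)<\infty$, $\hat\partial\varphi(\bar x)=\{v\mid\liminf_{x\to\bar x}\frac{\varphi(x)-\varphi(\bar x)-\langle v,x-\bar x\rangle}{\|x-\bar x\|}\ge0\}$; the limiting subdifferential $\partial\varphi(\bar x)$ is the set of all $v$ for which there are $x_k\to\bar x$ with $\varphi(x_k)\to\varphi(\bar x)$ and $v_k\in\hat\partial\varphi(x_k)$ with $v_k\to v$ weakly. $\partial_xg(x,p):=\partial g_p(x)$, $\operatorname{gph}\partial_xg=\{(x,p,v)\mid v\in\partial_xg(x,p)\}$. The regular normal cone is $\hat N_\Omega(\bar x)=\hat\partial\delta_\Omega(\bar x)$, with $\delta_\Omega$ the indicator function. The regular coderivative of $F\colon X\rightrightarrows X$ at $(x,y)\in\operatorname{gph}F$ is $\hat D^*F(x,y)(w)=\{z\mid(z,-w)\in\hat N_{\operatorname{gph}F}(x,y)\}$. Lipschitz-like. A set-valued mapping $F$ from a metric space $(M,d)$ to a normed space is Lipschitz-like around $(\bar m,\bar y)\in\operatorname{gph}F$ if there are $\ell>0$ and neighborhoods $U$ of $\bar m$, $V$ of $\bar y$ with $F(m)\cap V\subset F(m')+\ell d(m,m')\mathbb B$ for all $m,m'\in U$.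 Assumptions. (A2) $g$ is parametrically continuously prox-regular at $(\bar x,\bar p)$ for $\hat v$, i.e. (a) there are neighborhoods $U$ of $\bar x$, $V$ of $\hat v$, $P$ of $\bar p$ and $\varepsilon,r>0$ with $g(x,p)\ge g(u,p)+\langle v,x-u\rangle-\frac r2\|x-u\|^2$ for all $x\in U$ whenever $v\in\partial_xg(u,p)\cap V$, $u\in U$, $p\in P$, $g(u,p)\le g(\bar x,\bar p)+\varepsilon$; and (b) $(x,p,v)\mapsto g(x,p)$ is continuous relative to $\operatorname{gph}\partial_xg$ at $(\bar x,\bar p,\hat v)$. The infimum of all $r>0$ for which (a) holds (with some $U,V,P,\varepsilon$) is the threshold of prox-regularity $\mathcal R$ of $g$ at $(\bar x,\bar p)$ for $\hat v$. (A3) The mapping $p\mapsto\operatorname{epi}g(\cdot,p)$ is Lipschitz-like around $(\bar p,(\bar x,g(\bar x,\bar p)))$.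
   Formalization: Assertion (i) is proved as τ > −∞; the value τ = +∞ is allowed, since it occurs under the stated assumptions (e.g. g(x,p)=|x|^{3/2} on the real line at 0), and (ii) is then read with max{0,−∞}=0. *)

theory Defs
  imports "HOL-Analysis.Analysis"
begin

text \<open>
  Extended-real-valued functions take values in \<open>ereal\<close>; the convention that
  \<open>-\<infinity>\<close> is not a value is imposed as a hypothesis where a function is introduced.
  The space \<open>X\<close> is identified with its dual, so subgradients and normals are vectors of \<open>X\<close>.
\<close>

definition lower_semicontinuous :: "('a::topological_space \<Rightarrow> ereal) \<Rightarrow> bool" where
  "lower_semicontinuous \<phi> \<longleftrightarrow> (\<forall>x. \<phi> x \<le> Liminf (at x) \<phi>)"

definition epi :: "('a \<Rightarrow> ereal) \<Rightarrow> ('a \<times> real) set" where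
  "epi \<phi> = {(x, \<alpha>). \<phi> x \<le> ereal \<alpha>}"

definition indicator_fun :: "'a set \<Rightarrow> 'a \<Rightarrow> ereal" where
  "indicator_fun \<Omega> x = (if x \<in> \<Omega> then 0 else \<infinity>)"

text \<open>Both subdifferentials are empty at points where the function is not finite.\<close>

definition regular_subdiff :: "('a::real_inner \<Rightarrow> ereal) \<Rightarrow> 'a \<Rightarrow> 'a set" where
  "regular_subdiff \<phi> x = {v. \<bar>\<phi> x\<bar> \<noteq> \<infinity> \<and>
     Liminf (at x) (\<lambda>y. (\<phi> y - \<phi> x - ereal (v \<bullet> (y - x))) / ereal (norm (y - x))) \<ge> 0}"

definition weakly_tendsto :: "(nat \<Rightarrow> 'a::real_inner) \<Rightarrow> 'a \<Rightarrow> bool" where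
  "weakly_tendsto v v' \<longleftrightarrow> (\<forall>w. (\<lambda>k. v k \<bullet> w) \<longlonglongrightarrow> v' \<bullet> w)"

definition limiting_subdiff :: "('a::real_inner \<Rightarrow> ereal) \<Rightarrow> 'a \<Rightarrow> 'a set" where
  "limiting_subdiff \<phi> x = {v. \<bar>\<phi> x\<bar> \<noteq> \<infinity> \<and>
     (\<exists>xs vs. xs \<longlonglongrightarrow> x \<and> (\<lambda>k. \<phi> (xs k)) \<longlonglongrightarrow> \<phi> x \<and>
        (\<forall>k. vs k \<in> regular_subdiff \<phi> (xs k)) \<and> weakly_tendsto vs v)}"

definition partial_subdiff ::
    "('a::real_inner \<times> 'p \<Rightarrow> ereal) \<Rightarrow> 'a \<Rightarrow> 'p \<Rightarrow> 'a set" where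
  "partial_subdiff g x p = limiting_subdiff (\<lambda>u. g (u, p)) x"

definition gph_partial_subdiff ::
    "('a::real_inner \<times> 'p \<Rightarrow> ereal) \<Rightarrow> ('a \<times> 'p \<times> 'a) set" where
  "gph_partial_subdiff g = {(x, p, v). v \<in> partial_subdiff g x p}"

definition regular_normal_cone :: "'a::real_inner set \<Rightarrow> 'a \<Rightarrow> 'a set" where
  "regular_normal_cone \<Omega> x = regular_subdiff (indicator_fun \<Omega>) x"

definition gph :: "('m \<Rightarrow> 'y set) \<Rightarrow> ('m \<times> 'y) set" where
  "gph F = {(m, y). y \<in> F m}"

definition regular_coderivative ::
    "('a::real_inner \<Rightarrow> 'b::real_inner set) \<Rightarrow> 'a \<Rightarrow> 'b \<Rightarrow> 'b \<Rightarrow> 'a set" where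
  "regular_coderivative F x y w = {z. (z, - w) \<in> regular_normal_cone (gph F) (x, y)}"

definition lipschitz_like ::
    "('m::metric_space \<Rightarrow> 'y::real_normed_vector set) \<Rightarrow> 'm \<Rightarrow> 'y \<Rightarrow> bool" where
  "lipschitz_like F m0 y0 \<longleftrightarrow> (m0, y0) \<in> gph F \<and>
     (\<exists>l>0. \<exists>U V. open U \<and> m0 \<in> U \<and> open V \<and> y0 \<in> V \<and>
        (\<forall>m\<in>U. \<forall>m'\<in>U.
           F m \<inter> V \<subseteq> {y + (l * dist m m') *\<^sub>R b | y b. y \<in> F m' \<and> b \<in> cball 0 1}))"

text \<open>Inequality (a) of parametric prox-regularity, with a fixed constant \<open>r\<close>.\<close>

definition prox_regular_with ::
    "('a::real_inner \<times> 'p::metric_space \<Rightarrow> ereal) \<Rightarrow> 'a \<Rightarrow> 'p \<Rightarrow> 'a \<Rightarrow> real \<Rightarrow> bool" where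
  "prox_regular_with g x0 p0 v0 r \<longleftrightarrow>
     (\<exists>U V P \<epsilon>. open U \<and> x0 \<in> U \<and> open V \<and> v0 \<in> V \<and> open P \<and> p0 \<in> P \<and> \<epsilon> > 0 \<and>
        (\<forall>u\<in>U. \<forall>p\<in>P. \<forall>v\<in>partial_subdiff g u p \<inter> V.
           g (u, p) \<le> g (x0, p0) + ereal \<epsilon> \<longrightarrow>
           (\<forall>x\<in>U. g (x, p) \<ge> g (u, p) + ereal (v \<bullet> (x - u)) - ereal (r / 2 * (norm (x - u))\<^sup>2))))"

definition param_cont_prox_regular ::
    "('a::real_inner \<times> 'p::metric_space \<Rightarrow> ereal) \<Rightarrow> 'a \<Rightarrow> 'p \<Rightarrow> 'a \<Rightarrow> bool" where
  "param_cont_prox_regular g x0 p0 v0 \<longleftrightarrow>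
     (\<exists>r>0. prox_regular_with g x0 p0 v0 r) \<and>
     continuous (at (x0, p0, v0) within gph_partial_subdiff g) (\<lambda>(x, p, v). g (x, p))"

definition prox_threshold ::
    "('a::real_inner \<times> 'p::metric_space \<Rightarrow> ereal) \<Rightarrow> 'a \<Rightarrow> 'p \<Rightarrow> 'a \<Rightarrow> ereal" where
  "prox_threshold g x0 p0 v0 = Inf {ereal r | r. r > 0 \<and> prox_regular_with g x0 p0 v0 r}"

text \<open>
  The infimum is taken in the extended reals, so it is \<open>\<infinity>\<close> over the empty set. This does occur:
  if \<open>g\<close> is the indicator function of a point, then \<open>z\<close> ranges over the empty set for every
  \<open>w \<noteq> 0\<close>. The limit as \<open>\<eta>\<close> tends to \<open>0\<close> can be \<open>\<infinity>\<close> for nonempty sets as well: take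
  \<open>g (x, p) = \<bar>x\<bar> powr (3/2)\<close> on the real line at \<open>0\<close>.
\<close>

definition coderivative_bound ::
    "('a::real_inner \<times> 'p::metric_space \<Rightarrow> ereal) \<Rightarrow> 'a \<Rightarrow> 'p \<Rightarrow> 'a \<Rightarrow> real \<Rightarrow> ereal" where
  "coderivative_bound g x0 p0 v0 \<eta> =
     Inf {ereal ((z \<bullet> w) / (norm w)\<^sup>2) | x p v z w.
            z \<in> regular_coderivative (\<lambda>u. partial_subdiff g u p) x v w \<and>
            (x, p, v) \<in> gph_partial_subdiff g \<inter> (cball x0 \<eta> \<times> cball p0 \<eta> \<times> cball v0 \<eta>) \<and>
            w \<noteq> 0}"

definition coderivative_limit ::
    "('a::real_inner \<times> 'p::metric_space \<Rightarrow> ereal) \<Rightarrow> 'a \<Rightarrow> 'p \<Rightarrow> 'a \<Rightarrow> ereal" where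
  "coderivative_limit g x0 p0 v0 = Lim (at_right 0) (coderivative_bound g x0 p0 v0)"

text \<open>The limit always exists in the extended reals, since the bound is antitone in \<open>\<eta>\<close>.\<close>

lemma coderivative_bound_antimono:
  assumes "\<eta> \<le> \<eta>'"
  shows "coderivative_bound g x0 p0 v0 \<eta>' \<le> coderivative_bound g x0 p0 v0 \<eta>"
proof -
  have "cball x0 \<eta> \<subseteq> cball x0 \<eta>'" "cball p0 \<eta> \<subseteq> cball p0 \<eta>'" "cball v0 \<eta> \<subseteq> cball v0 \<eta>'"
    using assms by auto
  then show ?thesis
    unfolding coderivative_bound_def by (intro Inf_superset_mono) blast
qed

lemma coderivative_bound_tendsto_SUP:
  "(coderivative_bound g x0 p0 v0 \<longlongrightarrow> (SUP \<eta>\<in>{0<..}. coderivative_bound g x0 p0 v0 \<eta>)) (at_right 0)"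
  (is "(?b \<longlongrightarrow> ?s) _")
proof (rule order_tendstoI)
  fix a assume "a < ?s"
  then obtain e where e: "e > 0" "a < ?b e"
    by (auto simp: less_SUP_iff)
  show "\<forall>\<^sub>F \<eta> in at_right 0. a < ?b \<eta>"
    unfolding eventually_at_right_field
    using e coderivative_bound_antimono[of _ e g x0 p0 v0]
    by (intro exI[of _ e]) (auto intro: less_le_trans)
next
  fix a assume "?s < a"
  then have "?b \<eta> < a" if "\<eta> > 0" for \<eta>
    using that by (meson SUP_upper greaterThan_iff le_less_trans)
  then show "\<forall>\<^sub>F \<eta> in at_right 0. ?b \<eta> < a"
    unfolding eventually_at_right_field by (intro exI[of _ 1]) auto
qed

lemma coderivative_limit_tendsto:
  "(coderivative_bound g x0 p0 v0 \<longlongrightarrow> coderivative_limit g x0 p0 v0) (at_right 0)"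
  unfolding coderivative_limit_def
  using coderivative_bound_tendsto_SUP[of g x0 p0 v0] tendsto_Lim[of "at_right (0::real)"]
  by (metis trivial_limit_at_right_real)

end

theory Submission
  imports Defs
begin

text \<open>
  Fix \<open>p\<close> near \<open>pbar\<close>, write \<open>\<phi> = g(\<cdot>, p)\<close>, and let \<open>\<sigma>\<close> be larger than the constants below. Near the
  reference point the inclusion \<open>y - \<sigma> (x - xbar) \<in> \<partial>\<phi>(x)\<close> has exactly one solution \<open>x = J(y)\<close>, so
  \<open>(x, v) \<mapsto> (v + \<sigma> (x - xbar), x)\<close> turns the graph of \<open>\<partial>\<phi>\<close> into the graph of a Lipschitz map.
  Under this linear change of variables the two sides of the theorem become primal and dual forms
  of one statement. Put \<open>\<kappa> = \<sigma> - r\<close> and \<open>G = 2\<kappa>J - I\<close>.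

  On the primal side, hypomonotonicity \<open>\<langle>v - v', x - x'\<rangle> \<ge> -r \<parallel>x - x'\<parallel>\<^sup>2\<close> of \<open>\<partial>\<phi>\<close> reads
  \<open>\<kappa> \<parallel>Jy - Jy'\<parallel>\<^sup>2 \<le> \<langle>y - y', Jy - Jy'\<rangle>\<close>, and completing the square this says that \<open>G\<close> is
  nonexpansive (\<open>cocoercive_iff_nonexpansive\<close>). On the dual side, the coderivative inequality
  \<open>\<langle>z, w\<rangle> \<ge> -r \<parallel>w\<parallel>\<^sup>2\<close> with \<open>a = z + \<sigma>w\<close> reads \<open>\<kappa> \<parallel>w\<parallel>\<^sup>2 \<le> \<langle>a, w\<rangle>\<close>, that is
  \<open>\<parallel>2\<kappa>w - a\<parallel> \<le> \<parallel>a\<parallel>\<close>, which bounds by \<open>\<parallel>a\<parallel>\<close> the regular subgradients of \<open>y \<mapsto> \<langle>a, G y\<rangle>\<close>.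

  A nonexpansive \<open>G\<close> satisfies the dual bound: evaluate the normal cone inequality along one
  well-chosen ray (\<open>prox_inequality_imp_coderivative_ge\<close>). Conversely, a function whose regular
  subgradients are bounded by \<open>L\<close> is \<open>L\<close>-Lipschitz
  (\<open>regular_subgradient_bound_imp_lipschitz\<close>), which gives back a nonexpansive \<open>G\<close>
  (\<open>coderivative_bound_imp_cocoercive\<close>). It remains to pass between hypomonotonicity and the
  quadratic inequality that defines prox-regularity. One way is adding two inequalities; the other
  minimises \<open>\<phi>\<close> minus the claimed minorant and finds that its minimiser can only be the base
  point (\<open>hypomonotone_imp_prox_inequality\<close>), at the price of an arbitrarily small increase of
  \<open>r\<close>, which the infimum in the threshold absorbs.

  In a Hilbert space a lower semicontinuous function need not attain its minimum on a ball. All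
  minimisation is therefore done after a small smooth perturbation, in the manner of Borwein and
  Preiss (\<open>smooth_variational_principle\<close>). The Lipschitz-like epigraphs make the domain
  of \<open>J\<close> uniform in \<open>p\<close> (\<open>epigraph_lipschitz_bounds\<close>), and continuity of \<open>g\<close> along the graph of
  the subdifferential makes the bound on \<open>g(u, p)\<close> in the definition of prox-regularity hold
  automatically (\<open>prox_regular_with_iff_prox_inequality\<close>).
\<close>

section \<open>Regular subgradients and normals\<close>

text \<open>
  Clearing the denominator in the difference quotient gives a form without division in the extended
  reals, which is easier to combine with other estimates.
\<close>
lemma regular_subdiff_iff:
  fixes \<phi> :: "'a::real_inner \<Rightarrow> ereal"
  shows "v \<in> regular_subdiff \<phi> x \<longleftrightarrow> \<bar>\<phi> x\<bar> \<noteq> \<infinity> \<and>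
    (\<forall>e>0. \<forall>\<^sub>F y in at x. \<phi> x + ereal (v \<bullet> (y - x) - e * norm (y - x)) \<le> \<phi> y)"
proof -
  let ?q = "\<lambda>y. (\<phi> y - \<phi> x - ereal (v \<bullet> (y - x))) / ereal (norm (y - x))"
  have key: "ereal (- e) \<le> ?q y \<longleftrightarrow> \<phi> x + ereal (v \<bullet> (y - x) - e * norm (y - x)) \<le> \<phi> y"
    if y: "y \<noteq> x" and fin: "\<bar>\<phi> x\<bar> \<noteq> \<infinity>" for y e
  proof -
    have n: "norm (y - x) > 0" using y by simp
    obtain a where a: "\<phi> x = ereal a" using fin by auto
    show ?thesis
      using n by (cases "\<phi> y") (auto simp: a field_simps)
  qed
  have "0 \<le> Liminf (at x) ?q \<longleftrightarrow> (\<forall>e>0. \<forall>\<^sub>F y in at x. ereal (- e) \<le> ?q y)"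
  proof
    assume L: "0 \<le> Liminf (at x) ?q"
    show "\<forall>e>0. \<forall>\<^sub>F y in at x. ereal (- e) \<le> ?q y"
    proof (intro allI impI)
      fix e :: real assume "e > 0"
      then have "ereal (- e) < 0" by simp
      then have "\<forall>\<^sub>F y in at x. ereal (- e) < ?q y"
        using L unfolding le_Liminf_iff by blast
      then show "\<forall>\<^sub>F y in at x. ereal (- e) \<le> ?q y"
        by (rule eventually_mono) (rule less_imp_le)
    qed
  next
    assume R: "\<forall>e>0. \<forall>\<^sub>F y in at x. ereal (- e) \<le> ?q y"
    show "0 \<le> Liminf (at x) ?q"
      unfolding le_Liminf_iff
    proof (intro allI impI)
      fix c :: ereal assume "c < 0"
      then obtain b where b: "c < ereal b" "ereal b < 0" using ereal_dense2 by blast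
      then have "\<forall>\<^sub>F y in at x. ereal (- (- b)) \<le> ?q y" using R[rule_format, of "- b"] by simp
      then show "\<forall>\<^sub>F y in at x. c < ?q y"
        using b(1) by (auto elim!: eventually_mono intro: less_le_trans)
    qed
  qed
  moreover have "(\<forall>\<^sub>F y in at x. ereal (- e) \<le> ?q y) \<longleftrightarrow>
      (\<forall>\<^sub>F y in at x. \<phi> x + ereal (v \<bullet> (y - x) - e * norm (y - x)) \<le> \<phi> y)"
    if "\<bar>\<phi> x\<bar> \<noteq> \<infinity>" for e
    using key[OF _ that] by (intro eventually_cong) (auto simp: eventually_at_filter)
  ultimately show ?thesis
    unfolding regular_subdiff_def by auto
qed

lemma regular_normal_cone_iff:
  "n \<in> regular_normal_cone \<Omega> x \<longleftrightarrow>
    x \<in> \<Omega> \<and> (\<forall>e>0. \<forall>\<^sub>F y in nhds x. y \<in> \<Omega> \<longrightarrow> n \<bullet> (y - x) \<le> e * norm (y - x))"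
proof -
  have "(\<forall>\<^sub>F y in at x. 0 + ereal (n \<bullet> (y - x) - e * norm (y - x)) \<le> indicator_fun \<Omega> y) \<longleftrightarrow>
     (\<forall>\<^sub>F y in nhds x. y \<in> \<Omega> \<longrightarrow> n \<bullet> (y - x) \<le> e * norm (y - x))" for e
    unfolding eventually_at_filter
    by (rule eventually_cong[OF always_eventually])
       (auto simp: indicator_fun_def zero_ereal_def simp del: ereal_eq_0)
  then show ?thesis
    unfolding regular_normal_cone_def regular_subdiff_iff
    by (auto simp: indicator_fun_def)
qed

lemma regular_coderivative_iff:
  "z \<in> regular_coderivative F x v w \<longleftrightarrow> v \<in> F x \<and>
    (\<forall>e>0. \<forall>\<^sub>F (x', v') in nhds (x, v). v' \<in> F x' \<longrightarrow>
       z \<bullet> (x' - x) - w \<bullet> (v' - v) \<le> e * norm (x' - x, v' - v))"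
  unfolding regular_coderivative_def mem_Collect_eq regular_normal_cone_iff
  by (simp add: gph_def case_prod_unfold inner_prod_def minus_prod_def)

text \<open>
  The source of all regular subgradients in this development: minimality of a perturbed function is
  turned into a smooth minorant touching at the minimiser.
\<close>
lemma smooth_minorant_regular_subdiff:
  fixes \<phi> :: "'a::real_inner \<Rightarrow> ereal"
  assumes fin: "\<bar>\<phi> x\<bar> \<noteq> \<infinity>"
    and der: "(q has_derivative (\<lambda>h. w \<bullet> h)) (at x)"
    and le: "\<forall>\<^sub>F y in at x. \<phi> x + ereal (q y - q x) \<le> \<phi> y"
  shows "w \<in> regular_subdiff \<phi> x"
  unfolding regular_subdiff_iff
proof (intro conjI allI impI fin)
  fix e :: real assume "e > 0"
  with der obtain d where d: "d > 0"
    "\<And>y. norm (y - x) < d \<Longrightarrow> norm (q y - q x - w \<bullet> (y - x)) \<le> e * norm (y - x)"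
    unfolding has_derivative_at_alt by blast
  have "\<forall>\<^sub>F y in at x. norm (y - x) < d"
    using d(1) unfolding eventually_at dist_norm by auto
  with le show "\<forall>\<^sub>F y in at x. \<phi> x + ereal (w \<bullet> (y - x) - e * norm (y - x)) \<le> \<phi> y"
  proof eventually_elim
    case (elim y)
    have "w \<bullet> (y - x) - e * norm (y - x) \<le> q y - q x"
      using d(2)[OF elim(2)] by (simp add: abs_le_iff)
    then have "\<phi> x + ereal (w \<bullet> (y - x) - e * norm (y - x)) \<le> \<phi> x + ereal (q y - q x)"
      by (intro add_left_mono) simp
    then show ?case using elim(1) by (rule order_trans)
  qed
qed

lemma regular_subset_limiting: "regular_subdiff \<phi> x \<subseteq> limiting_subdiff \<phi> x"
proof
  fix v assume v: "v \<in> regular_subdiff \<phi> x"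
  have fin: "\<bar>\<phi> x\<bar> \<noteq> \<infinity>" using v by (simp add: regular_subdiff_def)
  show "v \<in> limiting_subdiff \<phi> x"
    unfolding limiting_subdiff_def
    by (rule CollectI, rule conjI[OF fin], rule exI[of _ "\<lambda>_. x"], rule exI[of _ "\<lambda>_. v"])
       (simp add: v weakly_tendsto_def)
qed

section \<open>Lower semicontinuity\<close>

lemma lower_semicontinuous_nhds:
  assumes "lower_semicontinuous \<phi>" "c < \<phi> x"
  shows "\<forall>\<^sub>F y in nhds x. c < \<phi> y"
proof -
  have "\<forall>\<^sub>F y in at x. c < \<phi> y"
    using assms unfolding lower_semicontinuous_def le_Liminf_iff by blast
  then show ?thesis
    unfolding eventually_at_filter by eventually_elim (use assms(2) in auto)
qed

lemma lower_semicontinuous_seq: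
  fixes \<phi> :: "'a::topological_space \<Rightarrow> ereal"
  assumes "lower_semicontinuous \<phi>" "xs \<longlonglongrightarrow> x" "as \<longlonglongrightarrow> a"
    and "\<And>n. \<phi> (xs n) \<le> ereal (as n)"
  shows "\<phi> x \<le> ereal a"
proof (rule ccontr)
  assume "\<not> \<phi> x \<le> ereal a"
  then obtain c where c: "ereal a < ereal c" "ereal c < \<phi> x"
    using ereal_dense2 by (metis not_le)
  have "\<forall>\<^sub>F n in sequentially. ereal c < \<phi> (xs n)"
    using lower_semicontinuous_nhds[OF assms(1) c(2)] assms(2) by (rule eventually_compose_filterlim)
  moreover have "\<forall>\<^sub>F n in sequentially. as n < c"
    using c(1) assms(3) by (auto dest: order_tendstoD)
  ultimately have "\<forall>\<^sub>F n in sequentially. False"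
  proof eventually_elim
    case (elim n)
    then show ?case using assms(4)[of n] by (cases "\<phi> (xs n)") auto
  qed
  then show False by simp
qed

lemma lower_semicontinuous_section:
  fixes g :: "'a::topological_space \<times> 'p::topological_space \<Rightarrow> ereal"
  assumes "lower_semicontinuous g"
  shows "lower_semicontinuous (\<lambda>x. g (x, p))"
  unfolding lower_semicontinuous_def le_Liminf_iff
proof (intro allI impI)
  fix x c assume "c < g (x, p)"
  have "filterlim (\<lambda>y. (y, p)) (nhds (x, p)) (at x)"
    by (intro tendsto_intros)
  then show "\<forall>\<^sub>F y in at x. c < g (y, p)"
    by (rule eventually_compose_filterlim[OF lower_semicontinuous_nhds[OF assms \<open>c < g (x, p)\<close>]])
qed

section \<open>A smooth variational principle\<close>

text \<open>
  Start at \<open>x0\<close>, add to \<open>f\<close> a small multiple of the squared distance to \<open>x0\<close>, move to an approximate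
  minimiser of the sum, and repeat there with a smaller multiple. The added term forces consecutive approximate minimisers
  together, so that they converge, and the limit minimises \<open>f\<close> plus the series of all penalties. In
  a Hilbert space this series of quadratics is again a quadratic; its gradient at the limit is the
  vector \<open>e\<close>, which is small because the total weight is.
\<close>
lemma smooth_variational_principle:
  fixes f :: "'a::{real_inner,complete_space} \<Rightarrow> real"
  assumes cl: "closed {(x, a). x \<in> D \<and> f x \<le> a}"
    and lb: "\<And>x. x \<in> D \<Longrightarrow> m \<le> f x"
    and bD: "bounded D" and x0: "x0 \<in> D" and \<eta>: "\<eta> > 0"
  obtains x e where "x \<in> D" "f x \<le> f x0" "norm e \<le> \<eta>"
    "\<And>u. u \<in> D \<Longrightarrow> f x \<le> f u + e \<bullet> (u - x) + \<eta> * (norm (u - x))\<^sup>2"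
proof -
  obtain B where B: "B > 0" "\<And>x y. x \<in> D \<Longrightarrow> y \<in> D \<Longrightarrow> dist x y \<le> B"
    using bD unfolding bounded_two_points by (metis less_eq_real_def linorder_not_le order_trans zero_less_one)
  \<comment> \<open>The total weight of the penalties: at most \<open>\<eta>\<close> for the quadratic term, and at most
    \<open>\<eta> / (2B)\<close> because \<open>e\<close> is twice a weighted sum of vectors of norm at most \<open>B\<close>.\<close>
  define \<mu> where "\<mu> = min \<eta> (\<eta> / (2 * B))"
  have \<mu>: "\<mu> > 0" "\<mu> \<le> \<eta>" "2 * B * \<mu> \<le> \<eta>"
    using \<eta> B(1) by (auto simp: \<mu>_def field_simps min_def)
  define w where "w n = \<mu> * (1/2) ^ Suc n" for n :: nat
  have w_pos: "w n > 0" for n using \<mu> by (simp add: w_def)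
  have w_sums: "w sums \<mu>"
    unfolding w_def using sums_mult[OF power_half_series, of \<mu>] by simp
  have w_part: "(\<Sum>k<n. w k) \<le> \<mu>" for n
    using sum_le_suminf[of w "{..<n}"] w_sums w_pos by (simp add: sums_iff less_imp_le)
  \<comment> \<open>The accuracy at stage \<open>n\<close>. Dividing it by the weight \<open>w n\<close> bounds squared distances, so the
    factor \<open>4 ^ -n\<close> makes the distances decay like \<open>2 ^ -n\<close>. At stage \<open>0\<close> any accuracy will do; the one
    chosen is attained by the given point \<open>x0\<close>.\<close>
  define s where "s n = (if n = 0 then f x0 - m else w n * (1/4) ^ n)" for n :: nat
  \<comment> \<open>A state pairs the current point with the current penalised function.\<close>
  define P where "P n z \<longleftrightarrow> fst z \<in> D \<and> (\<forall>u\<in>D. m \<le> snd z u) \<and> (\<forall>u\<in>D. snd z (fst z) \<le> snd z u + s n) \<and>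
      (n = 0 \<longrightarrow> z = (x0, f))" for n and z :: "'a \<times> ('a \<Rightarrow> real)"
  define Q where "Q n z z' \<longleftrightarrow> snd z' = (\<lambda>u. snd z u + w n * (norm (u - fst z))\<^sup>2) \<and>
      snd z' (fst z') \<le> snd z (fst z)" for n and z z' :: "'a \<times> ('a \<Rightarrow> real)"
  have "\<exists>Z. \<forall>n. P n (Z n) \<and> Q n (Z n) (Z (Suc n))"
  proof (rule dependent_nat_choice)
    have "P 0 (x0, f)" using x0 lb by (auto simp: P_def s_def)
    then show "\<exists>z. P 0 z" ..
  next
    fix z n assume z: "P n z"
    define h where "h = (\<lambda>u. snd z u + w n * (norm (u - fst z))\<^sup>2)"
    have hm: "m \<le> h u" if "u \<in> D" for u
      using z that w_pos[of n] by (auto simp: P_def h_def intro: add_increasing2)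
    have sp: "s (Suc n) > 0" using w_pos by (simp add: s_def)
    have bdd: "bdd_below (h ` D)" using hm by (rule bdd_belowI2)
    have ne: "h ` D \<noteq> {}" using x0 by auto
    have "\<exists>v\<in>D. h v \<le> Inf (h ` D) + s (Suc n) \<and> h v \<le> h (fst z)"
    proof (cases "h (fst z) \<le> Inf (h ` D) + s (Suc n)")
      case True
      then show ?thesis using z by (auto simp: P_def)
    next
      case False
      have "Inf (h ` D) < Inf (h ` D) + s (Suc n)" using sp by simp
      then obtain v where "v \<in> D" "h v < Inf (h ` D) + s (Suc n)"
        unfolding cInf_less_iff[OF ne bdd] by blast
      then show ?thesis using False by (intro bexI[of _ v]) linarith+
    qed
    then obtain v where v: "v \<in> D" "h v \<le> Inf (h ` D) + s (Suc n)" "h v \<le> h (fst z)" by blast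
    have "h v \<le> h u + s (Suc n)" if "u \<in> D" for u
      using v(2) cInf_lower[OF _ bdd, of "h u"] that by force
    then have "P (Suc n) (v, h)" using v hm by (auto simp: P_def)
    moreover have "Q n z (v, h)" using v by (auto simp: Q_def h_def)
    ultimately show "\<exists>z'. P (Suc n) z' \<and> Q n z z'" by blast
  qed
  then obtain Z where Z: "\<And>n. P n (Z n)" "\<And>n. Q n (Z n) (Z (Suc n))" by blast
  define xs where "xs n = fst (Z n)" for n
  define F where "F n = snd (Z n)" for n
  have xD: "xs n \<in> D" and Fs: "u \<in> D \<Longrightarrow> F n (xs n) \<le> F n u + s n" for n u
    using Z(1)[of n] by (auto simp: P_def xs_def F_def)
  have Fm: "u \<in> D \<Longrightarrow> m \<le> F n u" for n u using Z(1)[of n] by (auto simp: P_def xs_def F_def)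
  have init: "xs 0 = x0" "F 0 = f" using Z(1)[of 0] by (auto simp: P_def xs_def F_def)
  have Fsuc: "F (Suc n) u = F n u + w n * (norm (u - xs n))\<^sup>2" for n u
    using Z(2)[of n] by (auto simp: Q_def xs_def F_def)
  have Fdec: "F (Suc n) (xs (Suc n)) \<le> F n (xs n)" for n
    using Z(2)[of n] by (auto simp: Q_def xs_def F_def)
  have Feq: "F n u = f u + (\<Sum>k<n. w k * (norm (u - xs k))\<^sup>2)" for n u
    by (induction n) (auto simp: init Fsuc)
  have decs: "decseq (\<lambda>n. F n (xs n))" using Fdec by (rule decseq_SucI)
  have Finc: "F k u \<le> F n u" if "k \<le> n" for k n u
    using that
  proof (induction rule: dec_induct)
    case (step n)
    then show ?case using w_pos[of n] by (auto simp: Fsuc intro: add_increasing2)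
  qed simp
  have "m \<le> F n (xs n)" for n by (rule Fm[OF xD])
  then have "\<forall>n. m \<le> F n (xs n)" ..
  from decseq_convergent[OF decs this] obtain L where L: "(\<lambda>n. F n (xs n)) \<longlonglongrightarrow> L" by metis
  have LF: "L \<le> F n (xs n)" for n using decseq_ge[OF decs L] .
  have dist_le: "norm (xs k - xs n) \<le> (1/2) ^ n" if "n > 0" "k \<ge> n" for k n
  proof (cases "k = n")
    case False
    then have "F (Suc n) (xs k) \<le> F k (xs k)" using that by (intro Finc) auto
    also have "\<dots> \<le> F n (xs n)" using decs that by (auto simp: decseq_def)
    also have "\<dots> \<le> F n (xs k) + w n * (1/4) ^ n" using Fs[OF xD[of k], of n] that by (simp add: s_def)
    finally have "w n * (norm (xs k - xs n))\<^sup>2 \<le> w n * (1/4) ^ n" by (simp add: Fsuc)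
    then have "(norm (xs k - xs n))\<^sup>2 \<le> ((1/2) ^ n)\<^sup>2"
      using w_pos[of n] by (simp add: power_mult_distrib[symmetric] power2_eq_square)
    then show ?thesis by (rule power2_le_imp_le) simp
  qed simp
  have "Cauchy xs"
  proof (rule CauchyI)
    fix \<epsilon> :: real assume "\<epsilon> > 0"
    then obtain N where N: "(1/2::real) ^ N < \<epsilon>" using real_arch_pow_inv[of \<epsilon> "1/2"] by auto
    have "(1/2::real) ^ Suc N \<le> (1/2) ^ N / 2" by simp
    have "norm (xs i - xs j) < \<epsilon>" if "i \<ge> Suc N" "j \<ge> Suc N" for i j
    proof -
      have "norm (xs i - xs j) \<le> norm (xs i - xs (Suc N)) + norm (xs j - xs (Suc N))"
        by (metis dist_norm dist_triangle2)
      also have "\<dots> \<le> (1/2) ^ Suc N + (1/2) ^ Suc N"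
        using dist_le[of "Suc N"] that by (intro add_mono) auto
      also have "\<dots> < \<epsilon>" using N by simp
      finally show ?thesis .
    qed
    then show "\<exists>M. \<forall>i\<ge>M. \<forall>j\<ge>M. norm (xs i - xs j) < \<epsilon>" by blast
  qed
  then obtain x where x: "xs \<longlonglongrightarrow> x" using Cauchy_convergent_iff convergent_def by blast
  define S where "S n u = (\<Sum>k<n. w k * (norm (u - xs k))\<^sup>2)" for n u
  \<comment> \<open>Truncating the penalties at a fixed stage \<open>N\<close> keeps them continuous, so the closed epigraph of
    \<open>f\<close> can be used in place of lower semicontinuity of an infinite sum.\<close>
  have lim: "x \<in> D \<and> f x \<le> L - S N x" for N
  proof -
    have lim: "(\<lambda>n. (xs (n + N), F (n + N) (xs (n + N)) - S N (xs (n + N)))) \<longlonglongrightarrow> (x, L - S N x)"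
      unfolding S_def
      by (intro tendsto_intros LIMSEQ_ignore_initial_segment[OF L] LIMSEQ_ignore_initial_segment[OF x])
    have mem: "(xs (n + N), F (n + N) (xs (n + N)) - S N (xs (n + N))) \<in> {(x, a). x \<in> D \<and> f x \<le> a}" for n
      using xD Finc[of N "n + N" "xs (n + N)"] by (simp add: Feq[of N] S_def)
    from closed_sequentially[OF cl mem lim] show ?thesis by simp
  qed
  have xD': "x \<in> D" using lim by blast
  define E where "E n = (\<Sum>k<n. (2 * w k) *\<^sub>R (x - xs k))" for n
  \<comment> \<open>The partial sums of the gradients are compared with a convergent real series.\<close>
  define C where "C n = (\<Sum>k<n. w k * (2 * B))" for n
  have EC: "norm (E j - E i) \<le> \<bar>C j - C i\<bar>" if "i \<le> j" for i j
  proof -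
    have "E j - E i = (\<Sum>k=i..<j. (2 * w k) *\<^sub>R (x - xs k))" "C j - C i = (\<Sum>k=i..<j. w k * (2 * B))"
      using that by (auto simp: E_def C_def lessThan_atLeast0 sum_diff_nat_ivl)
    moreover have "norm (\<Sum>k=i..<j. (2 * w k) *\<^sub>R (x - xs k)) \<le> (\<Sum>k=i..<j. w k * (2 * B))"
      using B(2)[OF xD' xD] w_pos by (intro sum_norm_le) (simp add: dist_norm less_imp_le)
    ultimately show ?thesis by simp
  qed
  have "Cauchy C"
    using sums_mult2[OF w_sums, of "2 * B"] unfolding C_def sums_def by (rule LIMSEQ_imp_Cauchy)
  have "Cauchy E"
  proof (rule CauchyI)
    fix \<epsilon> :: real assume "\<epsilon> > 0"
    then obtain M where M: "\<And>i j. i \<ge> M \<Longrightarrow> j \<ge> M \<Longrightarrow> norm (C i - C j) < \<epsilon>"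
      using CauchyD[OF \<open>Cauchy C\<close>] by blast
    have "norm (E i - E j) < \<epsilon>" if "i \<ge> M" "j \<ge> M" for i j
      using M[OF that] EC[of i j] EC[of j i] norm_minus_commute[of "E i" "E j"]
      by (cases "i \<le> j") (auto simp: abs_minus_commute)
    then show "\<exists>M. \<forall>i\<ge>M. \<forall>j\<ge>M. norm (E i - E j) < \<epsilon>" by blast
  qed
  have nE: "norm (E n) \<le> \<eta>" for n
  proof -
    have "norm (E n) \<le> (\<Sum>k<n. w k * (2 * B))"
      unfolding E_def using B(2)[OF xD' xD] w_pos
      by (intro sum_norm_le) (simp add: dist_norm less_imp_le)
    also have "\<dots> \<le> \<mu> * (2 * B)"
      using w_part[of n] B(1) by (simp add: sum_distrib_right[symmetric])
    finally show ?thesis using \<mu>(3) by (simp add: mult_ac)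
  qed
  obtain e where e: "E \<longlonglongrightarrow> e"
    using \<open>Cauchy E\<close> Cauchy_convergent_iff convergent_def by blast
  have ne: "norm e \<le> \<eta>" using nE by (intro Lim_norm_ubound[OF _ e]) auto
  have sum_id: "S n u - S n x = E n \<bullet> (u - x) + (\<Sum>k<n. w k) * (norm (u - x))\<^sup>2" for n u
    unfolding S_def E_def inner_sum_left sum_distrib_right sum_subtractf[symmetric] sum.distrib[symmetric]
  proof (rule sum.cong[OF refl])
    fix k
    have expand: "(norm (u - xs k))\<^sup>2 = (norm (u - x))\<^sup>2 + 2 * ((x - xs k) \<bullet> (u - x)) + (norm (x - xs k))\<^sup>2"
      unfolding power2_norm_eq_inner by (simp add: inner_diff_left inner_diff_right inner_commute algebra_simps)
    show "w k * (norm (u - xs k))\<^sup>2 - w k * (norm (x - xs k))\<^sup>2 =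
        (2 * w k) *\<^sub>R (x - xs k) \<bullet> (u - x) + w k * (norm (u - x))\<^sup>2"
      unfolding expand inner_scaleR_left by (simp only: ring_distribs)
  qed
  have s0: "s \<longlonglongrightarrow> 0"
  proof (rule Lim_null_comparison)
    have "norm (s n) \<le> w n" if "n \<ge> 1" for n
      using that w_pos[of n] by (auto simp: s_def power_le_one mult_left_le)
    then show "\<forall>\<^sub>F n in sequentially. norm (s n) \<le> w n" using eventually_sequentially by blast
    show "w \<longlonglongrightarrow> 0" using w_sums summable_LIMSEQ_zero sums_iff by blast
  qed
  have "f x \<le> f u + e \<bullet> (u - x) + \<eta> * (norm (u - x))\<^sup>2" if u: "u \<in> D" for u
  proof -
    have "f x \<le> f u + E n \<bullet> (u - x) + \<eta> * (norm (u - x))\<^sup>2 + s n" for n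
    proof -
      have "f x + S n x \<le> F n (xs n)" using lim[of n] LF[of n] by simp
      also have "\<dots> \<le> f u + S n u + s n" using Fs[OF u, of n] by (simp add: Feq S_def)
      finally have "f x \<le> f u + (S n u - S n x) + s n" by simp
      also have "\<dots> \<le> f u + (E n \<bullet> (u - x) + \<eta> * (norm (u - x))\<^sup>2) + s n"
        unfolding sum_id using w_part[of n] \<mu>(2) by (intro add_mono mult_right_mono order_refl) auto
      finally show ?thesis by simp
    qed
    moreover have "(\<lambda>n. f u + E n \<bullet> (u - x) + \<eta> * (norm (u - x))\<^sup>2 + s n)
        \<longlonglongrightarrow> f u + e \<bullet> (u - x) + \<eta> * (norm (u - x))\<^sup>2 + 0"
      by (intro tendsto_intros e s0)
    ultimately show ?thesis using LIMSEQ_le_const by fastforce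
  qed
  moreover have "f x \<le> f x0" using lim[of 0] LF[of 0] by (simp add: init S_def)
  ultimately show thesis using that xD' ne by blast
qed

text \<open>
  The variational principle asks for a real-valued function with closed epigraph; this restricts an
  extended-real-valued one to its effective domain.
\<close>
lemma closed_epigraph_add_continuous:
  fixes \<phi> :: "'a::metric_space \<Rightarrow> ereal"
  assumes lsc: "lower_semicontinuous \<phi>" and proper: "\<And>x. \<phi> x \<noteq> - \<infinity>"
    and C: "closed C" and q: "continuous_on UNIV q"
  shows "closed {(x, a). x \<in> {x \<in> C. \<phi> x < \<infinity>} \<and> real_of_ereal (\<phi> x) + q x \<le> a}" (is "closed ?E")
  unfolding closed_sequential_limits
proof (intro allI impI, elim conjE)
  fix z l assume z: "\<forall>n. z n \<in> ?E" and l: "z \<longlonglongrightarrow> l"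
  obtain x a where l_eq: "l = (x, a)" by (cases l)
  have x: "(\<lambda>n. fst (z n)) \<longlonglongrightarrow> x" and a: "(\<lambda>n. snd (z n)) \<longlonglongrightarrow> a"
    using tendsto_fst[OF l] tendsto_snd[OF l] by (simp_all add: l_eq)
  have "(\<lambda>n. q (fst (z n))) \<longlonglongrightarrow> q x"
    using continuous_on_tendsto_compose[OF q x] by simp
  then have lim: "(\<lambda>n. snd (z n) - q (fst (z n))) \<longlonglongrightarrow> a - q x" using a by (intro tendsto_diff)
  have le: "\<phi> (fst (z n)) \<le> ereal (snd (z n) - q (fst (z n)))" for n
    using z[rule_format, of n] proper[of "fst (z n)"] by (cases "\<phi> (fst (z n))") (auto simp: case_prod_beta)
  have "\<phi> x \<le> ereal (a - q x)" by (rule lower_semicontinuous_seq[OF lsc x lim le])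
  moreover have "x \<in> C"
    by (rule closed_sequentially[OF C _ x]) (use z in \<open>auto simp: case_prod_beta\<close>)
  ultimately show "l \<in> ?E"
    using proper[of x] by (cases "\<phi> x") (auto simp: l_eq)
qed

text \<open>
  The form in which the variational principle is applied: a minimiser that cannot lie on the sphere
  yields a regular subgradient of \<open>\<phi>\<close>, up to an error \<open>e\<close> of norm at most \<open>\<eta>\<close>. Differentiability
  of \<open>q\<close> is asked only at the minimiser, since \<open>q\<close> is once a norm penalty with a kink.
\<close>
lemma perturbed_minimum:
  fixes \<phi> :: "'a::{real_inner,complete_space} \<Rightarrow> ereal"
  assumes lsc: "lower_semicontinuous \<phi>" and proper: "\<And>x. \<phi> x \<noteq> - \<infinity>"
    and q: "continuous_on UNIV q"
    and x0: "x0 \<in> cball c R" "\<phi> x0 < \<infinity>"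
    and lb: "\<And>x. x \<in> cball c R \<Longrightarrow> ereal m \<le> \<phi> x + ereal (q x)"
    and inner: "\<And>x. x \<in> cball c R \<Longrightarrow> \<phi> x + ereal (q x) \<le> \<phi> x0 + ereal (q x0) \<Longrightarrow> x \<in> ball c R"
    and \<eta>: "\<eta> > 0"
  obtains x e where "x \<in> ball c R" "norm e \<le> \<eta>" "\<phi> x < \<infinity>"
    "\<phi> x + ereal (q x) \<le> \<phi> x0 + ereal (q x0)"
    "\<And>w. (q has_derivative (\<lambda>h. w \<bullet> h)) (at x) \<Longrightarrow> e - w \<in> regular_subdiff \<phi> x"
    "\<And>u. u \<in> cball c R \<Longrightarrow> \<phi> x + ereal (q x) \<le> \<phi> u + ereal (q u + \<eta> * norm (u - x) + \<eta> * (norm (u - x))\<^sup>2)"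
proof -
  define D where "D = {x \<in> cball c R. \<phi> x < \<infinity>}"
  define f where "f x = real_of_ereal (\<phi> x) + q x" for x
  have fD: "\<phi> x + ereal (q x) = ereal (f x)" "\<phi> x = ereal (f x - q x)" if "x \<in> D" for x
    using that proper[of x] by (cases "\<phi> x"; auto simp: D_def f_def)+
  have cl: "closed {(x, a). x \<in> D \<and> f x \<le> a}"
    unfolding D_def f_def by (rule closed_epigraph_add_continuous[OF lsc proper closed_cball q])
  have bD: "bounded D" unfolding D_def by (rule bounded_subset[OF bounded_cball]) auto
  have x0D: "x0 \<in> D" using x0 by (simp add: D_def)
  have mf: "m \<le> f x" if "x \<in> D" for x
    using lb[of x] fD(1)[OF that] that by (simp add: D_def)
  obtain x e where x: "x \<in> D" "f x \<le> f x0" "norm e \<le> \<eta>"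
    and min: "\<And>u. u \<in> D \<Longrightarrow> f x \<le> f u + e \<bullet> (u - x) + \<eta> * (norm (u - x))\<^sup>2"
    using smooth_variational_principle[OF cl mf bD x0D \<eta>] by blast
  have le0: "\<phi> x + ereal (q x) \<le> \<phi> x0 + ereal (q x0)" using x fD x0D by simp
  have xb: "x \<in> ball c R" using inner[OF _ le0] x(1) by (simp add: D_def)
  show thesis
  proof (rule that[of x "- e"])
    fix w assume w: "(q has_derivative (\<lambda>h. w \<bullet> h)) (at x)"
    define p where "p u = - q u - e \<bullet> u - \<eta> * ((u - x) \<bullet> (u - x))" for u
    have "(p has_derivative (\<lambda>h. (- e - w) \<bullet> h)) (at x)"
      unfolding p_def
      by (rule has_derivative_eq_rhs, (rule derivative_intros w)+)
         (simp add: inner_diff_left fun_eq_iff)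
    moreover have "\<forall>\<^sub>F u in at x. \<phi> x + ereal (p u - p x) \<le> \<phi> u"
    proof -
      have "\<forall>\<^sub>F u in at x. u \<in> ball c R"
        using xb by (intro eventually_at_in_open') auto
      then show ?thesis
      proof eventually_elim
        case (elim u)
        show ?case
        proof (cases "\<phi> u < \<infinity>")
          case True
          then have u: "u \<in> D" using elim by (auto simp: D_def)
          have "f x + (p u - p x) \<le> f u - q u + q x"
            using min[OF u] by (simp add: p_def inner_diff_right power2_norm_eq_inner)
          then show ?thesis using fD(2)[OF u] fD(2)[OF x(1)] by simp
        qed auto
      qed
    qed
    moreover have "\<bar>\<phi> x\<bar> \<noteq> \<infinity>" using fD(2)[OF x(1)] by simp
    ultimately show "- e - w \<in> regular_subdiff \<phi> x"
      by (intro smooth_minorant_regular_subdiff)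
  next
    fix u assume u: "u \<in> cball c R"
    show "\<phi> x + ereal (q x) \<le> \<phi> u + ereal (q u + \<eta> * norm (u - x) + \<eta> * (norm (u - x))\<^sup>2)"
    proof (cases "\<phi> u < \<infinity>")
      case True
      then have uD: "u \<in> D" using u by (simp add: D_def)
      have "e \<bullet> (u - x) \<le> \<eta> * norm (u - x)"
        by (rule order_trans[OF norm_cauchy_schwarz]) (use x(3) in \<open>simp add: mult_right_mono\<close>)
      then show ?thesis using min[OF uD] fD(1)[OF x(1)] fD(2)[OF uD] by simp
    qed auto
  qed (use x xb le0 in \<open>auto simp: D_def\<close>)
qed

section \<open>Bounded regular subgradients give a Lipschitz constant\<close>

lemma lower_semicontinuous_restrict:
  fixes \<psi> :: "'a::topological_space \<Rightarrow> real"
  assumes C: "closed C" and \<psi>: "continuous_on C \<psi>"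
  shows "lower_semicontinuous (\<lambda>x. if x \<in> C then ereal (\<psi> x) else \<infinity>)"
  unfolding lower_semicontinuous_def le_Liminf_iff
proof (intro allI impI)
  fix x a assume a: "a < (if x \<in> C then ereal (\<psi> x) else \<infinity>)"
  show "\<forall>\<^sub>F y in at x. a < (if y \<in> C then ereal (\<psi> y) else \<infinity>)"
  proof (cases "x \<in> C")
    case True
    then have "((\<lambda>y. ereal (\<psi> y)) \<longlongrightarrow> ereal (\<psi> x)) (at x within C)"
      using \<psi> by (auto simp: continuous_on_def)
    from order_tendstoD(1)[OF this, of a]
    have "\<forall>\<^sub>F y in at x within C. a < ereal (\<psi> y)" using a True by simp
    then show ?thesis
      unfolding eventually_at_filter using a by (auto elim!: eventually_mono split: if_splits)
  next
    case False
    then have "\<forall>\<^sub>F y in at x. y \<in> - C"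
      using C by (intro eventually_at_in_open') auto
    then show ?thesis by eventually_elim (use a False in auto)
  qed
qed

text \<open>
  Regular subgradients are local, so that a function may be set to \<open>\<infinity>\<close> away from the point without
  changing them.
\<close>
lemma regular_subdiff_cong:
  assumes "v \<in> regular_subdiff \<phi> x" "\<forall>\<^sub>F y in nhds x. \<phi> y = \<psi> y"
  shows "v \<in> regular_subdiff \<psi> x"
proof -
  have eq: "\<phi> x = \<psi> x" using eventually_nhds_x_imp_x[OF assms(2)] .
  have ev: "\<forall>\<^sub>F y in at x. \<phi> y = \<psi> y"
    using assms(2) unfolding eventually_at_filter by (rule eventually_mono) simp
  from assms(1) have fin: "\<bar>\<psi> x\<bar> \<noteq> \<infinity>"
    and sub: "\<forall>e>0. \<forall>\<^sub>F y in at x. \<psi> x + ereal (v \<bullet> (y - x) - e * norm (y - x)) \<le> \<phi> y"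
    unfolding regular_subdiff_iff eq by (rule conjunct1, rule conjunct2)
  have "\<forall>\<^sub>F y in at x. \<psi> x + ereal (v \<bullet> (y - x) - e * norm (y - x)) \<le> \<psi> y" if "e > 0" for e
    using sub[rule_format, OF that] ev by eventually_elim (simp only:)
  then show ?thesis unfolding regular_subdiff_iff by (intro conjI allI impI fin)
qed

lemma distance_penalty_derivative:
  fixes y0 :: "'a::real_inner"
  assumes "y \<noteq> y0"
  shows "((\<lambda>y. a * norm (y - y0) + b * (norm (y - y0))\<^sup>2) has_derivative
     (\<lambda>h. ((a / norm (y - y0) + 2 * b) *\<^sub>R (y - y0)) \<bullet> h)) (at y)"
proof -
  have n: "((\<lambda>y. norm (y - y0)) has_derivative (\<lambda>h. h \<bullet> sgn (y - y0))) (at y)"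
    by (rule has_derivative_compose[where f = "\<lambda>y. y - y0" and f' = "\<lambda>h. h" and g = norm])
       (use assms in \<open>auto intro!: derivative_eq_intros has_derivative_norm\<close>)
  have "((\<lambda>y. (y - y0) \<bullet> (y - y0)) has_derivative (\<lambda>h. (y - y0) \<bullet> h + h \<bullet> (y - y0))) (at y)"
    by (intro has_derivative_inner) (auto intro!: derivative_eq_intros)
  then have s: "((\<lambda>y. (norm (y - y0))\<^sup>2) has_derivative (\<lambda>h. (y - y0) \<bullet> h + h \<bullet> (y - y0))) (at y)"
    by (simp only: power2_norm_eq_inner)
  show ?thesis
    by (rule has_derivative_eq_rhs[OF has_derivative_add[OF has_derivative_mult_right[OF n] has_derivative_mult_right[OF s]]])
       (simp add: fun_eq_iff sgn_div_norm inner_commute[of _ "y - y0"] distrib_right divide_inverse)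
qed

text \<open>
  Minimise \<open>\<psi>\<close> plus a penalty whose slope exceeds \<open>L\<close> everywhere except at its vertex \<open>y0\<close>. Away from
  \<open>y0\<close> the penalty is smooth and a minimiser would carry a subgradient longer than \<open>L\<close>, hence the
  minimiser is \<open>y0\<close>. The a priori constant \<open>K\<close> may exceed \<open>L\<close>; the quadratic part of the penalty
  is there to keep the minimiser off the sphere in that case.
\<close>
lemma regular_subgradient_bound_imp_local_estimate:
  fixes \<psi> :: "'a::{real_inner,complete_space} \<Rightarrow> real"
  assumes K: "\<And>x. x \<in> cball y0 \<rho> \<Longrightarrow> \<bar>\<psi> x - \<psi> y0\<bar> \<le> K * norm (x - y0)" and "K \<ge> 0"
    and cont: "continuous_on (cball y0 \<rho>) \<psi>"
    and L: "\<And>x b. x \<in> ball y0 \<rho> \<Longrightarrow> b \<in> regular_subdiff (\<lambda>x. ereal (\<psi> x)) x \<Longrightarrow> norm b \<le> L"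
    and "L \<ge> 0" and "\<rho> > 0" and y: "y \<in> cball y0 \<rho>"
  shows "\<psi> y0 - \<psi> y \<le> L * norm (y - y0) + (K + 1) / \<rho> * (norm (y - y0))\<^sup>2"
proof -
  define M where "M = (K + 1) / \<rho>"
  have M: "M > 0" "M * \<rho> = K + 1" using assms by (auto simp: M_def)
  have est: "\<psi> y0 - \<psi> y \<le> L * norm (y - y0) + M * (norm (y - y0))\<^sup>2 + \<eta> * (3 * norm (y - y0) + (norm (y - y0))\<^sup>2)"
    if \<eta>: "\<eta> > 0" for \<eta>
  proof -
    define \<phi> where "\<phi> x = (if x \<in> cball y0 \<rho> then ereal (\<psi> x) else \<infinity>)" for x
    define q where "q x = (L + 2 * \<eta>) * norm (x - y0) + M * (norm (x - y0))\<^sup>2" for x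
    have q0: "q x \<ge> M * (norm (x - y0))\<^sup>2" "q x \<ge> 0" for x
      using \<open>L \<ge> 0\<close> \<eta> M(1) by (auto simp: q_def)
    have lsc: "lower_semicontinuous \<phi>"
      unfolding \<phi>_def by (rule lower_semicontinuous_restrict[OF closed_cball cont])
    have proper: "\<phi> x \<noteq> - \<infinity>" for x by (simp add: \<phi>_def)
    have qc: "continuous_on UNIV q" unfolding q_def by (intro continuous_intros)
    have y0: "y0 \<in> cball y0 \<rho>" "\<phi> y0 < \<infinity>" using \<open>\<rho> > 0\<close> by (auto simp: \<phi>_def)
    have lb: "ereal (\<psi> y0 - K * \<rho>) \<le> \<phi> x + ereal (q x)" if "x \<in> cball y0 \<rho>" for x
    proof -
      have "K * norm (x - y0) \<le> K * \<rho>" using that \<open>K \<ge> 0\<close> by (intro mult_left_mono) (auto simp: dist_norm norm_minus_commute)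
      then show ?thesis using K[OF that] q0(2)[of x] that by (simp add: \<phi>_def)
    qed
    have inner: "x \<in> ball y0 \<rho>" if x: "x \<in> cball y0 \<rho>" and le: "\<phi> x + ereal (q x) \<le> \<phi> y0 + ereal (q y0)" for x
    proof (rule ccontr)
      assume "x \<notin> ball y0 \<rho>"
      then have n: "norm (x - y0) = \<rho>" using x by (simp add: dist_norm norm_minus_commute)
      have "\<psi> x + q x \<le> \<psi> y0" using le x y0 by (simp add: \<phi>_def q_def)
      then have "M * \<rho>\<^sup>2 \<le> K * \<rho>" using K[OF x] q0(1)[of x] by (simp add: n)
      then have "(K + 1) * \<rho> \<le> K * \<rho>" using M(2) by (simp add: power2_eq_square mult.assoc[symmetric])
      then show False using \<open>\<rho> > 0\<close> by (simp add: algebra_simps)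
    qed
    obtain x e where x: "x \<in> ball y0 \<rho>" "norm e \<le> \<eta>"
      and sub: "\<And>w. (q has_derivative (\<lambda>h. w \<bullet> h)) (at x) \<Longrightarrow> e - w \<in> regular_subdiff \<phi> x"
      and min: "\<And>u. u \<in> cball y0 \<rho> \<Longrightarrow> \<phi> x + ereal (q x) \<le> \<phi> u + ereal (q u + \<eta> * norm (u - x) + \<eta> * (norm (u - x))\<^sup>2)"
      by (rule perturbed_minimum[OF lsc proper qc y0 lb inner \<eta>]; (assumption | (rule that; assumption)))
    \<comment> \<open>The slope \<open>L + 2 \<eta>\<close> still exceeds \<open>L\<close> after subtracting the error \<open>e\<close> of norm at most \<open>\<eta>\<close>.\<close>
    have "x = y0"
    proof (rule ccontr)
      assume "x \<noteq> y0"
      define w where "w = ((L + 2 * \<eta>) / norm (x - y0) + 2 * M) *\<^sub>R (x - y0)"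
      have "e - w \<in> regular_subdiff \<phi> x"
        unfolding w_def by (rule sub, unfold q_def, rule distance_penalty_derivative[OF \<open>x \<noteq> y0\<close>])
      moreover have "\<forall>\<^sub>F u in nhds x. u \<in> ball y0 \<rho>"
        using x(1) by (intro eventually_nhds_in_open) auto
      then have "\<forall>\<^sub>F u in nhds x. \<phi> u = ereal (\<psi> u)"
        by eventually_elim (auto simp: \<phi>_def)
      ultimately have "norm (e - w) \<le> L" by (rule L[OF x(1) regular_subdiff_cong])
      moreover have "norm w = L + 2 * \<eta> + 2 * M * norm (x - y0)"
      proof -
        define t where "t = norm (x - y0)"
        have t: "t > 0" using \<open>x \<noteq> y0\<close> by (simp add: t_def)
        then have "(L + 2 * \<eta>) / t + 2 * M \<ge> 0" using \<open>L \<ge> 0\<close> \<eta> M(1) by simp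
        then have "norm w = ((L + 2 * \<eta>) / t + 2 * M) * t"
          unfolding w_def t_def[symmetric] norm_scaleR by (simp only: abs_of_nonneg)
        also have "\<dots> = L + 2 * \<eta> + 2 * M * t" using t by (simp add: field_simps)
        finally show ?thesis by (simp add: t_def)
      qed
      moreover have "norm w \<le> norm (e - w) + norm e"
        using norm_triangle_ineq4[of e "e - w"] by simp
      moreover have "2 * M * norm (x - y0) \<ge> 0" using M(1) by simp
      ultimately show False using x(2) \<eta> by linarith
    qed
    then show ?thesis
      using min[OF y] y y0 by (simp add: \<phi>_def q_def algebra_simps)
  qed
  define S where "S = 3 * norm (y - y0) + (norm (y - y0))\<^sup>2"
  have "S \<ge> 0" by (simp add: S_def)
  have "\<psi> y0 - \<psi> y \<le> L * norm (y - y0) + M * (norm (y - y0))\<^sup>2 + \<epsilon>" if "\<epsilon> > 0" for \<epsilon>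
  proof -
    have "\<epsilon> / (S + 1) * S \<le> \<epsilon>" using \<open>S \<ge> 0\<close> that by (simp add: field_simps)
    then show ?thesis using est[of "\<epsilon> / (S + 1)"] \<open>S \<ge> 0\<close> that unfolding S_def[symmetric] by simp
  qed
  then show ?thesis unfolding M_def[symmetric] by (rule field_le_epsilon)
qed

text \<open>
  The quadratic term of the local estimate is removed by cutting the segment into \<open>n\<close> equal
  pieces: the sum of the \<open>n\<close> quadratic errors is of order \<open>1 / n\<close>. Halving the radius leaves room for
  balls of one fixed size around each point of the segment.
\<close>
lemma regular_subgradient_bound_imp_lipschitz:
  fixes \<psi> :: "'a::{real_inner,complete_space} \<Rightarrow> real"
  assumes K: "\<And>x y. x \<in> ball c R \<Longrightarrow> y \<in> ball c R \<Longrightarrow> \<bar>\<psi> x - \<psi> y\<bar> \<le> K * norm (x - y)"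
    and "K \<ge> 0" "L \<ge> 0"
    and L: "\<And>x b. x \<in> ball c R \<Longrightarrow> b \<in> regular_subdiff (\<lambda>x. ereal (\<psi> x)) x \<Longrightarrow> norm b \<le> L"
    and x: "x \<in> ball c (R / 2)" and y: "y \<in> ball c (R / 2)"
  shows "\<psi> x - \<psi> y \<le> L * norm (x - y)"
proof -
  have "0 \<le> dist c x" by simp
  then have R: "R > 0" using x by (simp only: mem_ball)
  define \<rho> where "\<rho> = R / 4"
  define M where "M = (K + 1) / \<rho>"
  have \<rho>: "\<rho> > 0" using R by (simp add: \<rho>_def)
  have loc: "\<psi> u - \<psi> v \<le> L * norm (v - u) + M * (norm (v - u))\<^sup>2"
    if u: "u \<in> ball c (R / 2)" and v: "norm (v - u) \<le> \<rho>" for u v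
  proof -
    have sub: "cball u \<rho> \<subseteq> ball c R"
    proof
      fix z assume "z \<in> cball u \<rho>"
      then show "z \<in> ball c R" using u dist_triangle[of c z u] R by (simp add: \<rho>_def)
    qed
    have u': "u \<in> ball c R" using sub \<rho> by (meson centre_in_cball less_imp_le subsetD)
    have "continuous_on (ball c R) \<psi>"
      using K \<open>K \<ge> 0\<close> by (intro lipschitz_on_continuous_on lipschitz_onI) (auto simp: dist_norm)
    then have "continuous_on (cball u \<rho>) \<psi>" using sub by (rule continuous_on_subset)
    show ?thesis
      unfolding M_def
    proof (rule regular_subgradient_bound_imp_local_estimate)
      show "continuous_on (cball u \<rho>) \<psi>" by fact
      show "\<bar>\<psi> x - \<psi> u\<bar> \<le> K * norm (x - u)" if "x \<in> cball u \<rho>" for x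
        using K[OF _ u'] sub that by blast
      show "norm b \<le> L" if "x \<in> ball u \<rho>" "b \<in> regular_subdiff (\<lambda>x. ereal (\<psi> x)) x" for x b
        using L[OF _ that(2)] sub that(1) by (meson ball_subset_cball subsetD)
      show "v \<in> cball u \<rho>" using v by (simp add: dist_norm norm_minus_commute)
    qed (use assms(2,3) \<rho> in auto)
  qed
  define z where "z n k = x + (real k / real n) *\<^sub>R (y - x)" for n k :: nat
  define s where "s = norm (y - x)"
  have bound: "\<psi> x - \<psi> y \<le> L * s + M * s\<^sup>2 / real n" if n: "real n \<ge> s / \<rho>" "n > 0" for n
  proof -
    have zb: "z n k \<in> ball c (R / 2)" if "k \<le> n" for k
    proof -
      have "z n k = (1 - real k / real n) *\<^sub>R x + (real k / real n) *\<^sub>R y"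
        by (simp add: z_def algebra_simps)
      then show ?thesis
        using convexD_alt[OF convex_ball x y, of "real k / real n"] that \<open>n > 0\<close> by simp
    qed
    have zd: "norm (z n (Suc k) - z n k) = s / real n" for k
    proof -
      have "z n (Suc k) - z n k = (1 / real n) *\<^sub>R (y - x)"
        by (simp add: z_def add_divide_distrib scaleR_add_left)
      then show ?thesis by (simp add: s_def)
    qed
    have small: "s / real n \<le> \<rho>" using n \<rho> by (simp add: field_simps)
    have "\<psi> (z n 0) - \<psi> (z n n) = (\<Sum>k<n. \<psi> (z n k) - \<psi> (z n (Suc k)))"
      by (rule sum_lessThan_telescope'[symmetric])
    also have "\<dots> \<le> (\<Sum>k<n. L * (s / real n) + M * (s / real n)\<^sup>2)"
    proof (rule sum_mono)
      fix k assume "k \<in> {..<n}"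
      then show "\<psi> (z n k) - \<psi> (z n (Suc k)) \<le> L * (s / real n) + M * (s / real n)\<^sup>2"
        using loc[OF zb[of k], of "z n (Suc k)"] small by (simp add: zd)
    qed
    also have "\<dots> = L * s + M * s\<^sup>2 / real n"
      using \<open>n > 0\<close> by (simp add: field_simps power2_eq_square)
    finally show ?thesis using \<open>n > 0\<close> by (simp add: z_def)
  qed
  have "(\<lambda>n. L * s + M * s\<^sup>2 / real n) \<longlonglongrightarrow> L * s + 0"
    by (intro tendsto_intros lim_const_over_n)
  moreover have "\<exists>N. \<forall>n\<ge>N. \<psi> x - \<psi> y \<le> L * s + M * s\<^sup>2 / real n"
  proof -
    obtain N where "s / \<rho> \<le> real N" using real_arch_simple by blast
    then have "\<forall>n\<ge>Suc N. \<psi> x - \<psi> y \<le> L * s + M * s\<^sup>2 / real n" using bound by force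
    then show ?thesis by blast
  qed
  ultimately have "\<psi> x - \<psi> y \<le> L * s + 0" by (rule LIMSEQ_le_const)
  then show ?thesis by (simp add: s_def norm_minus_commute)
qed

section \<open>The prox-regularity inequality for a single function\<close>

text \<open>
  One radius serves for points, subgradients and the range of the inequality. In the parametrised
  setting continuity along the graph takes the place of an upper bound on \<open>\<phi> u\<close>.
\<close>
definition prox_inequality_on :: "('a::real_inner \<Rightarrow> ereal) \<Rightarrow> 'a \<Rightarrow> 'a \<Rightarrow> real \<Rightarrow> real \<Rightarrow> bool" where
  "prox_inequality_on \<phi> x0 v0 r \<rho> \<longleftrightarrow>
     (\<forall>u\<in>ball x0 \<rho>. \<forall>v\<in>ball v0 \<rho>. v \<in> limiting_subdiff \<phi> u \<longrightarrow>
        (\<forall>x\<in>ball x0 \<rho>. \<phi> u + ereal (v \<bullet> (x - u) - r / 2 * (norm (x - u))\<^sup>2) \<le> \<phi> x))"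

lemma prox_inequality_onD:
  assumes "prox_inequality_on \<phi> x0 v0 r \<rho>" "u \<in> ball x0 \<rho>" "v \<in> ball v0 \<rho>"
    "v \<in> limiting_subdiff \<phi> u" "x \<in> ball x0 \<rho>"
  shows "\<phi> u + ereal (v \<bullet> (x - u) - r / 2 * (norm (x - u))\<^sup>2) \<le> \<phi> x"
  using assms unfolding prox_inequality_on_def by blast

lemma prox_inequality_on_mono:
  assumes "prox_inequality_on \<phi> x0 v0 r \<rho>" "\<rho>' \<le> \<rho>"
  shows "prox_inequality_on \<phi> x0 v0 r \<rho>'"
  using assms subset_ball[OF assms(2)] unfolding prox_inequality_on_def by blast

lemma limiting_subdiff_finite: "v \<in> limiting_subdiff \<phi> u \<Longrightarrow> \<bar>\<phi> u\<bar> \<noteq> \<infinity>"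
  by (simp add: limiting_subdiff_def)

lemma prox_inequality_imp_hypomonotone:
  assumes P: "prox_inequality_on \<phi> x0 v0 r \<rho>"
    and u: "u \<in> ball x0 \<rho>" "v \<in> ball v0 \<rho>" "v \<in> limiting_subdiff \<phi> u"
    and u': "u' \<in> ball x0 \<rho>" "v' \<in> ball v0 \<rho>" "v' \<in> limiting_subdiff \<phi> u'"
  shows "- r * (norm (u - u'))\<^sup>2 \<le> (v - v') \<bullet> (u - u')"
proof -
  obtain a b where ab: "\<phi> u = ereal a" "\<phi> u' = ereal b"
    using limiting_subdiff_finite u(3) u'(3) by (metis ereal_infinity_cases abs_ereal.simps ereal_cases)
  have "a + (v \<bullet> (u' - u) - r / 2 * (norm (u' - u))\<^sup>2) \<le> b"
    using prox_inequality_onD[OF P u u'(1)] by (simp add: ab)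
  moreover have "b + (v' \<bullet> (u - u') - r / 2 * (norm (u - u'))\<^sup>2) \<le> a"
    using prox_inequality_onD[OF P u' u(1)] by (simp add: ab)
  moreover have "v \<bullet> (u' - u) + v' \<bullet> (u - u') = - ((v - v') \<bullet> (u - u'))"
    by (simp add: inner_diff_left inner_diff_right)
  ultimately show ?thesis by (simp add: norm_minus_commute[of u' u])
qed

text \<open>
  In general the limiting subdifferential is not closed without convergence of the function values.
  Here the prox-regularity inequality at \<open>us n\<close>, evaluated at \<open>u\<close>, bounds the function values from
  above and lower semicontinuity bounds them from below.
\<close>
lemma limiting_subdiff_strong_limit:
  fixes \<phi> :: "'a::real_inner \<Rightarrow> ereal"
  assumes lsc: "lower_semicontinuous \<phi>" and proper: "\<And>x. \<phi> x \<noteq> - \<infinity>"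
    and P: "prox_inequality_on \<phi> x0 v0 r \<rho>"
    and us: "us \<longlonglongrightarrow> u" and vs: "vs \<longlonglongrightarrow> v" and u: "u \<in> ball x0 \<rho>"
    and mem: "\<And>n. us n \<in> ball x0 \<rho>" "\<And>n. vs n \<in> ball v0 \<rho>" "\<And>n. vs n \<in> regular_subdiff \<phi> (us n)"
  shows "v \<in> limiting_subdiff \<phi> u"
proof -
  have lim: "vs n \<in> limiting_subdiff \<phi> (us n)" for n
    using regular_subset_limiting mem(3) by blast
  define a where "a n = real_of_ereal (\<phi> (us n))" for n
  have a: "\<phi> (us n) = ereal (a n)" for n
    using limiting_subdiff_finite[OF lim[of n]] by (cases "\<phi> (us n)") (auto simp: a_def)
  define m where "m z n = vs n \<bullet> (z - us n) - r / 2 * (norm (z - us n))\<^sup>2" for z n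
  have m: "a n + m z n \<le> real_of_ereal (\<phi> z)" if "z \<in> ball x0 \<rho>" "\<bar>\<phi> z\<bar> \<noteq> \<infinity>" for z n
    using prox_inequality_onD[OF P mem(1,2) lim that(1), of n] that(2)
    by (cases "\<phi> z") (auto simp: a m_def)
  have m_lim: "m z \<longlonglongrightarrow> v \<bullet> (z - u) - r / 2 * (norm (z - u))\<^sup>2" for z
    unfolding m_def by (intro tendsto_intros us vs)
  have "(\<lambda>n. a 0 - m (us 0) n) \<longlonglongrightarrow> a 0 - (v \<bullet> (us 0 - u) - r / 2 * (norm (us 0 - u))\<^sup>2)"
    by (intro tendsto_diff tendsto_const m_lim)
  moreover have "\<phi> (us n) \<le> ereal (a 0 - m (us 0) n)" for n
    using m[OF mem(1)[of 0], of n] by (simp add: a)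
  ultimately have "\<phi> u \<le> ereal (a 0 - (v \<bullet> (us 0 - u) - r / 2 * (norm (us 0 - u))\<^sup>2))"
    by (rule lower_semicontinuous_seq[OF lsc us])
  then have fin: "\<bar>\<phi> u\<bar> \<noteq> \<infinity>" using proper[of u] by auto
  then obtain b where b: "\<phi> u = ereal b" by auto
  have "(\<lambda>n. a n) \<longlonglongrightarrow> b"
  proof (rule order_tendstoI)
    fix c assume "c < b"
    then have "ereal c < \<phi> u" by (simp add: b)
    from eventually_compose_filterlim[OF lower_semicontinuous_nhds[OF lsc this] us]
    show "\<forall>\<^sub>F n in sequentially. c < a n" by (simp add: a)
  next
    fix c assume "b < c"
    have "(\<lambda>n. b - m u n) \<longlonglongrightarrow> b - 0"
      using m_lim[of u] by (intro tendsto_diff tendsto_const) simp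
    then have "\<forall>\<^sub>F n in sequentially. b - m u n < c" using \<open>b < c\<close> by (auto dest: order_tendstoD)
    then show "\<forall>\<^sub>F n in sequentially. a n < c"
    proof eventually_elim
      case (elim n)
      then show ?case using m[OF u fin, of n] by (simp add: b)
    qed
  qed
  then have "(\<lambda>n. \<phi> (us n)) \<longlonglongrightarrow> \<phi> u" by (simp add: a b)
  moreover have "weakly_tendsto vs v"
    unfolding weakly_tendsto_def by (intro allI tendsto_inner vs tendsto_const)
  ultimately show ?thesis
    unfolding limiting_subdiff_def using fin us mem(3) by blast
qed

text \<open>
  Solving \<open>y \<in> \<partial>\<phi>(x) + \<sigma> (x - x0)\<close> amounts to minimising \<open>\<phi>(x) + \<sigma>/2 \<parallel>x - x0\<parallel>\<^sup>2 - \<langle>y, x - x0\<rangle>\<close>. The lower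
  bound and the value at \<open>z\<close>, both perturbed by \<open>\<epsilon>\<close>, confine every point of \<open>cball x0 \<delta>\<close> with a
  value not above that at \<open>z\<close> to a ball of radius \<open>\<delta>'\<close>, because \<open>\<sigma>\<close> exceeds \<open>R\<close>. The variational principle
  solves the inclusion up to errors tending to \<open>0\<close>; since \<open>\<partial>\<phi> + \<sigma> I\<close> is locally strongly
  monotone, the approximate solutions form a Cauchy sequence, and the graph is closed.
\<close>
lemma resolvent_solvable:
  fixes \<phi> :: "'a::{real_inner,complete_space} \<Rightarrow> ereal"
  assumes lsc: "lower_semicontinuous \<phi>" and proper: "\<And>x. \<phi> x \<noteq> - \<infinity>"
    and P: "prox_inequality_on \<phi> x0 v0 R \<rho>" and \<sigma>: "0 \<le> R" "R < \<sigma>"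
    and lower: "\<And>x. x \<in> cball x0 \<delta> \<Longrightarrow> ereal (g0 + v0 \<bullet> (x - x0) - R / 2 * (norm (x - x0))\<^sup>2 - \<epsilon>) \<le> \<phi> x"
    and upper: "z \<in> cball x0 \<epsilon>" "\<phi> z \<le> ereal (g0 + \<epsilon>)"
    and \<epsilon>: "0 < \<epsilon>" "\<epsilon> \<le> 1" "\<epsilon> \<le> \<delta>" and \<delta>': "0 < \<delta>'" "\<delta>' \<le> \<delta>" "\<delta>' < \<rho> / 2" "\<epsilon> + \<sigma> * \<delta>' < \<rho>"
    and small: "\<epsilon> * (3 + norm v0 + \<sigma> + \<delta>) < (\<sigma> - R) / 2 * \<delta>'\<^sup>2"
    and y: "norm (y - v0) \<le> \<epsilon>"
  shows "\<exists>x. norm (x - x0) \<le> \<delta>' \<and> y - \<sigma> *\<^sub>R (x - x0) \<in> limiting_subdiff \<phi> x"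
proof -
  define q where "q x = \<sigma> / 2 * ((x - x0) \<bullet> (x - x0)) - y \<bullet> (x - x0)" for x
  have qc: "continuous_on UNIV q" unfolding q_def by (intro continuous_intros)
  have qd: "(q has_derivative (\<lambda>h. (\<sigma> *\<^sub>R (x - x0) - y) \<bullet> h)) (at x)" for x
    unfolding q_def
    by (auto intro!: derivative_eq_intros simp: fun_eq_iff inner_diff_left inner_diff_right inner_commute)
  have z: "z \<in> cball x0 \<delta>" "\<phi> z < \<infinity>" using upper \<epsilon>(3) by (auto intro: le_less_trans)
  have ydiff: "\<bar>(v0 - y) \<bullet> (x - x0)\<bar> \<le> \<epsilon> * \<delta>" if "x \<in> cball x0 \<delta>" for x
    by (rule order_trans[OF Cauchy_Schwarz_ineq2])
       (use y that \<epsilon>(1) in \<open>auto simp: dist_norm norm_minus_commute intro!: mult_mono\<close>)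
  have lb: "ereal (g0 - \<epsilon> - \<epsilon> * \<delta> + (\<sigma> - R) / 2 * (norm (x - x0))\<^sup>2) \<le> \<phi> x + ereal (q x)"
    if "x \<in> cball x0 \<delta>" for x
    using lower[OF that] ydiff[OF that]
    by (cases "\<phi> x") (auto simp: q_def power2_norm_eq_inner inner_diff_left algebra_simps abs_le_iff diff_divide_distrib)
  have qz: "q z \<le> \<epsilon> * (1 + norm v0 + \<sigma>)"
  proof -
    have n: "norm (z - x0) \<le> \<epsilon>" using upper(1) by (simp add: dist_norm norm_minus_commute)
    have "\<bar>y \<bullet> (z - x0)\<bar> \<le> (1 + norm v0) * \<epsilon>"
      by (rule order_trans[OF Cauchy_Schwarz_ineq2], rule mult_mono)
         (use n y \<epsilon> norm_triangle_sub[of y v0] in auto)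
    moreover have "(norm (z - x0))\<^sup>2 \<le> \<epsilon> * 1"
      unfolding power2_eq_square using n \<epsilon> by (intro mult_mono) auto
    then have "\<sigma> / 2 * (norm (z - x0))\<^sup>2 \<le> \<sigma> / 2 * \<epsilon>" using \<sigma> by (intro mult_left_mono) auto
    moreover have "\<sigma> * \<epsilon> \<ge> 0" using \<sigma> \<epsilon> by simp
    ultimately show ?thesis by (simp add: q_def power2_norm_eq_inner[symmetric] algebra_simps abs_le_iff)
  qed
  have near: "norm (x - x0) < \<delta>'" if x: "x \<in> cball x0 \<delta>" and le: "\<phi> x + ereal (q x) \<le> \<phi> z + ereal (q z)" for x
  proof -
    have "\<phi> x + ereal (q x) \<le> ereal (g0 + \<epsilon>) + ereal (q z)"
      using le upper(2) by (meson add_right_mono order_trans)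
    from order_trans[OF lb[OF x] this]
    have "(\<sigma> - R) / 2 * (norm (x - x0))\<^sup>2 \<le> \<epsilon> * (3 + norm v0 + \<sigma> + \<delta>)"
      using qz by (simp add: algebra_simps)
    then have "(norm (x - x0))\<^sup>2 < \<delta>'\<^sup>2" using small \<sigma> by (smt (verit) divide_pos_pos mult_less_cancel_left_pos)
    then show ?thesis using \<delta>'(1) by (simp add: power_less_imp_less_base)
  qed
  have lb': "ereal (g0 - \<epsilon> - \<epsilon> * \<delta>) \<le> \<phi> x + ereal (q x)" if "x \<in> cball x0 \<delta>" for x
    by (rule order_trans[OF _ lb[OF that]]) (use \<sigma> in simp)
  have inner: "x \<in> ball x0 \<delta>" if "x \<in> cball x0 \<delta>" "\<phi> x + ereal (q x) \<le> \<phi> z + ereal (q z)" for x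
    using near[OF that] \<delta>'(2) by (simp add: dist_norm norm_minus_commute)
  \<comment> \<open>Half of the slack in \<open>\<epsilon> + \<sigma> * \<delta>' < \<rho>\<close>, spent on the errors of the approximate solutions.\<close>
  define \<gamma> where "\<gamma> = (\<rho> - \<epsilon> - \<sigma> * \<delta>') / 2"
  have \<gamma>: "\<gamma> > 0" "\<epsilon> + \<sigma> * \<delta>' + \<gamma> < \<rho>" using \<delta>'(4) by (auto simp: \<gamma>_def field_simps)
  have approx: "\<exists>x e. norm (x - x0) < \<delta>' \<and> norm e \<le> \<gamma> / real (Suc n) \<and>
      e + y - \<sigma> *\<^sub>R (x - x0) \<in> regular_subdiff \<phi> x" for n
  proof -
    have \<eta>: "\<gamma> / real (Suc n) > 0" using \<gamma> by simp
    obtain x e where "x \<in> ball x0 \<delta>" "norm e \<le> \<gamma> / real (Suc n)"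
      "\<phi> x + ereal (q x) \<le> \<phi> z + ereal (q z)"
      and sub: "\<And>w. (q has_derivative (\<lambda>h. w \<bullet> h)) (at x) \<Longrightarrow> e - w \<in> regular_subdiff \<phi> x"
      by (rule perturbed_minimum[OF lsc proper qc z lb' inner \<eta>]; (assumption | (rule that; assumption)))
    moreover have "e + y - \<sigma> *\<^sub>R (x - x0) \<in> regular_subdiff \<phi> x"
      using sub[OF qd] by (simp add: algebra_simps)
    moreover have "norm (x - x0) < \<delta>'"
      using calculation by (intro near) auto
    ultimately show ?thesis by blast
  qed
  then obtain xs es where xs: "\<And>n. norm (xs n - x0) < \<delta>'" and es: "\<And>n. norm (es n) \<le> \<gamma> / real (Suc n)"
    and sub: "\<And>n. es n + y - \<sigma> *\<^sub>R (xs n - x0) \<in> regular_subdiff \<phi> (xs n)"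
    by metis
  define vs where "vs n = es n + y - \<sigma> *\<^sub>R (xs n - x0)" for n
  have xb: "xs n \<in> ball x0 \<rho>" for n using xs[of n] \<delta>' by (simp add: dist_norm norm_minus_commute)
  have vb: "vs n \<in> ball v0 \<rho>" for n
  proof -
    have "\<gamma> / real (Suc n) \<le> \<gamma>" using \<gamma>(1) by (simp add: field_simps)
    then have "norm (es n) \<le> \<gamma>" using es[of n] by linarith
    moreover have "norm (\<sigma> *\<^sub>R (xs n - x0)) \<le> \<sigma> * \<delta>'" using xs[of n] \<sigma> by simp
    moreover have "vs n - v0 = es n + (y - v0) - \<sigma> *\<^sub>R (xs n - x0)" by (simp add: vs_def)
    then have "norm (vs n - v0) \<le> norm (es n) + norm (y - v0) + norm (\<sigma> *\<^sub>R (xs n - x0))"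
      by (metis add_right_mono norm_triangle_ineq norm_triangle_ineq4 order_trans)
    ultimately show ?thesis using y \<gamma>(2) by (simp add: dist_norm norm_minus_commute)
  qed
  have lim: "vs n \<in> limiting_subdiff \<phi> (xs n)" for n
    using sub regular_subset_limiting unfolding vs_def by blast
  have es0: "es \<longlonglongrightarrow> 0"
  proof (rule Lim_null_comparison)
    show "\<forall>\<^sub>F n in sequentially. norm (es n) \<le> \<gamma> * inverse (real (Suc n))"
      using es by (simp add: divide_inverse)
    show "(\<lambda>n. \<gamma> * inverse (real (Suc n))) \<longlonglongrightarrow> 0"
      using tendsto_mult_left[OF LIMSEQ_inverse_real_of_nat, of \<gamma>] by simp
  qed
  have diff: "(\<sigma> - R) * norm (xs i - xs j) \<le> norm (es i - es j)" for i j
  proof (cases "xs i = xs j")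
    case False
    have "- R * (norm (xs i - xs j))\<^sup>2 \<le> (vs i - vs j) \<bullet> (xs i - xs j)"
      by (rule prox_inequality_imp_hypomonotone[OF P xb vb lim xb vb lim])
    also have "vs i - vs j = (es i - es j) - \<sigma> *\<^sub>R (xs i - xs j)" by (simp add: vs_def algebra_simps)
    finally have "(\<sigma> - R) * (norm (xs i - xs j))\<^sup>2 \<le> (es i - es j) \<bullet> (xs i - xs j)"
      unfolding inner_diff_left[of "es i - es j"] inner_scaleR_left power2_norm_eq_inner by (simp add: left_diff_distrib)
    also have "\<dots> \<le> norm (es i - es j) * norm (xs i - xs j)" by (rule norm_cauchy_schwarz)
    finally show ?thesis using False by (simp add: power2_eq_square mult.assoc[symmetric])
  qed simp
  have "Cauchy xs"
  proof (rule CauchyI)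
    fix d :: real assume d: "d > 0"
    then have "(\<sigma> - R) * d > 0" using \<sigma> by simp
    from CauchyD[OF LIMSEQ_imp_Cauchy[OF es0] this]
    obtain M where M: "\<And>i j. i \<ge> M \<Longrightarrow> j \<ge> M \<Longrightarrow> norm (es i - es j) < (\<sigma> - R) * d" by blast
    have "norm (xs i - xs j) < d" if "i \<ge> M" "j \<ge> M" for i j
      using le_less_trans[OF diff M[OF that]] \<sigma> by simp
    then show "\<exists>M. \<forall>i\<ge>M. \<forall>j\<ge>M. norm (xs i - xs j) < d" by blast
  qed
  then obtain x where x: "xs \<longlonglongrightarrow> x" using Cauchy_convergent_iff convergent_def by blast
  have "norm (x - x0) \<le> \<delta>'"
  proof (rule LIMSEQ_le_const2)
    show "(\<lambda>n. norm (xs n - x0)) \<longlonglongrightarrow> norm (x - x0)" by (intro tendsto_intros x)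
  qed (use xs in \<open>auto intro: less_imp_le\<close>)
  moreover from this have "x \<in> ball x0 \<rho>" using \<delta>' by (simp add: dist_norm norm_minus_commute)
  moreover have "vs \<longlonglongrightarrow> 0 + y - \<sigma> *\<^sub>R (x - x0)"
    unfolding vs_def by (intro tendsto_intros es0 x)
  ultimately show ?thesis
    using limiting_subdiff_strong_limit[OF lsc proper P x _ _ xb vb] sub unfolding vs_def by fastforce
qed

section \<open>Uniformity in the parameter\<close>

lemma partial_subdiff_finite: "v \<in> partial_subdiff g x p \<Longrightarrow> \<bar>g (x, p)\<bar> \<noteq> \<infinity>"
  by (auto simp: partial_subdiff_def dest: limiting_subdiff_finite)

lemma prox_inequality_term_eq:
  "\<bar>a\<bar> \<noteq> \<infinity> \<Longrightarrow> a + ereal s - ereal t = a + ereal (s - t)"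
  by (cases a) auto

text \<open>
  Continuity of \<open>g\<close> relative to the graph of the subdifferential forces \<open>g (u, p) \<le> g (x0, p0) + \<epsilon>\<close> for
  all graph points near the reference point, so that the side condition of prox-regularity can be
  dropped after shrinking the neighbourhoods.
\<close>
lemma prox_regular_with_iff_prox_inequality:
  assumes cont: "continuous (at (x0, p0, v0) within gph_partial_subdiff g) (\<lambda>(x, p, v). g (x, p))"
    and fin: "\<bar>g (x0, p0)\<bar> \<noteq> \<infinity>"
  shows "prox_regular_with g x0 p0 v0 r \<longleftrightarrow>
    (\<exists>\<rho>>0. \<forall>p\<in>ball p0 \<rho>. prox_inequality_on (\<lambda>x. g (x, p)) x0 v0 r \<rho>)"
proof
  assume "prox_regular_with g x0 p0 v0 r"
  then obtain U V P \<epsilon> where UVP: "open U" "x0 \<in> U" "open V" "v0 \<in> V" "open P" "p0 \<in> P" and "\<epsilon> > 0"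
    and ineq: "\<forall>u\<in>U. \<forall>p\<in>P. \<forall>v\<in>partial_subdiff g u p \<inter> V. g (u, p) \<le> g (x0, p0) + ereal \<epsilon> \<longrightarrow>
        (\<forall>x\<in>U. g (x, p) \<ge> g (u, p) + ereal (v \<bullet> (x - u)) - ereal (r / 2 * (norm (x - u))\<^sup>2))"
    unfolding prox_regular_with_def by (elim exE conjE)
  from openE[OF UVP(1,2)] obtain d1 where d1: "d1 > 0" "ball x0 d1 \<subseteq> U" .
  from openE[OF UVP(3,4)] obtain d2 where d2: "d2 > 0" "ball v0 d2 \<subseteq> V" .
  from openE[OF UVP(5,6)] obtain d3 where d3: "d3 > 0" "ball p0 d3 \<subseteq> P" .
  note d = d1 d2 d3
  have "((\<lambda>(x, p, v). g (x, p)) \<longlongrightarrow> g (x0, p0)) (at (x0, p0, v0) within gph_partial_subdiff g)"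
    using cont by (simp add: continuous_within)
  moreover have lt: "g (x0, p0) < g (x0, p0) + ereal \<epsilon>"
    using fin \<open>\<epsilon> > 0\<close> by (cases "g (x0, p0)") auto
  ultimately have "\<forall>\<^sub>F z in at (x0, p0, v0) within gph_partial_subdiff g.
      (\<lambda>(x, p, v). g (x, p)) z < g (x0, p0) + ereal \<epsilon>"
    by (rule order_tendstoD(2))
  then obtain d4 where d4: "d4 > 0" "\<And>z. z \<in> gph_partial_subdiff g \<Longrightarrow> z \<noteq> (x0, p0, v0) \<Longrightarrow>
      dist z (x0, p0, v0) < d4 \<Longrightarrow> (\<lambda>(x, p, v). g (x, p)) z < g (x0, p0) + ereal \<epsilon>"
    unfolding eventually_at by blast
  define \<rho> where "\<rho> = Min {d1, d2, d3, d4 / 3}"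
  have \<rho>: "\<rho> > 0" "\<rho> \<le> d1" "\<rho> \<le> d2" "\<rho> \<le> d3" "3 * \<rho> \<le> d4"
    using d d4(1) by (auto simp: \<rho>_def min_def)
  have "prox_inequality_on (\<lambda>x. g (x, p)) x0 v0 r \<rho>" if p: "p \<in> ball p0 \<rho>" for p
    unfolding prox_inequality_on_def
  proof (intro ballI impI)
    fix u v x assume u: "u \<in> ball x0 \<rho>" and v: "v \<in> ball v0 \<rho>" and x: "x \<in> ball x0 \<rho>"
      and lim: "v \<in> limiting_subdiff (\<lambda>x. g (x, p)) u"
    then have sub: "v \<in> partial_subdiff g u p" by (simp add: partial_subdiff_def)
    have le: "g (u, p) \<le> g (x0, p0) + ereal \<epsilon>"
    proof (cases "(u, p, v) = (x0, p0, v0)")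
      case True then show ?thesis using lt by auto
    next
      case False
      have "dist (p, v) (p0, v0) \<le> dist p p0 + dist v v0"
        unfolding dist_prod_def by (auto intro: sqrt_sum_squares_le_sum)
      moreover have "dist (u, p, v) (x0, p0, v0) \<le> dist u x0 + dist (p, v) (p0, v0)"
        unfolding dist_prod_def[of "(u, p, v)"] by (auto intro: sqrt_sum_squares_le_sum)
      ultimately have "dist (u, p, v) (x0, p0, v0) < d4"
        using u v p \<rho>(5) by (simp add: dist_commute)
      then show ?thesis
        using d4(2)[of "(u, p, v)"] False sub by (simp add: gph_partial_subdiff_def)
    qed
    have "g (x, p) \<ge> g (u, p) + ereal (v \<bullet> (x - u)) - ereal (r / 2 * (norm (x - u))\<^sup>2)"
      using u v p x d \<rho> by (intro ineq[rule_format, OF _ _ _ le] IntI sub) auto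
    then show "g (u, p) + ereal (v \<bullet> (x - u) - r / 2 * (norm (x - u))\<^sup>2) \<le> g (x, p)"
      by (simp add: prox_inequality_term_eq[OF partial_subdiff_finite[OF sub]])
  qed
  then show "\<exists>\<rho>>0. \<forall>p\<in>ball p0 \<rho>. prox_inequality_on (\<lambda>x. g (x, p)) x0 v0 r \<rho>"
    using \<rho>(1) by blast
next
  assume "\<exists>\<rho>>0. \<forall>p\<in>ball p0 \<rho>. prox_inequality_on (\<lambda>x. g (x, p)) x0 v0 r \<rho>"
  then obtain \<rho> where \<rho>: "\<rho> > 0" "\<And>p. p \<in> ball p0 \<rho> \<Longrightarrow> prox_inequality_on (\<lambda>x. g (x, p)) x0 v0 r \<rho>"
    by blast
  show "prox_regular_with g x0 p0 v0 r"
    unfolding prox_regular_with_def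
  proof (intro exI conjI ballI impI)
    fix u p v x
    assume A: "u \<in> ball x0 \<rho>" "p \<in> ball p0 \<rho>" "v \<in> partial_subdiff g u p \<inter> ball v0 \<rho>" "x \<in> ball x0 \<rho>"
    then have "g (u, p) + ereal (v \<bullet> (x - u) - r / 2 * (norm (x - u))\<^sup>2) \<le> g (x, p)"
      using prox_inequality_onD[OF \<rho>(2)] by (simp add: partial_subdiff_def)
    then show "g (u, p) + ereal (v \<bullet> (x - u)) - ereal (r / 2 * (norm (x - u))\<^sup>2) \<le> g (x, p)"
      using prox_inequality_term_eq[OF partial_subdiff_finite[of v g u p]] A(3) by simp
  qed (use \<rho>(1) in \<open>auto intro: zero_less_one\<close>)
qed

lemma epigraph_lipschitz_shift:
  fixes F :: "'p::metric_space \<Rightarrow> ('a::real_normed_vector \<times> real) set"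
  assumes "F p \<inter> V \<subseteq> {y + (l * dist p p') *\<^sub>R b | y b. y \<in> F p' \<and> b \<in> cball 0 1}"
    and "(x, a) \<in> F p" "(x, a) \<in> V" "l \<ge> 0"
  obtains x' a' where "(x', a') \<in> F p'" "norm (x - x') \<le> l * dist p p'" "\<bar>a - a'\<bar> \<le> l * dist p p'"
proof -
  obtain x' a' b c where mem: "(x', a') \<in> F p'" and eq: "x = x' + (l * dist p p') *\<^sub>R b" "a = a' + (l * dist p p') * c"
    and n: "norm (b, c) \<le> 1"
    using assms(1-3) by fastforce
  have "norm b \<le> 1" "\<bar>c\<bar> \<le> 1"
    using n order_trans[OF norm_fst_le[of b c]] order_trans[OF norm_snd_le[of c b]] by simp_all
  moreover have "l * dist p p' \<ge> 0" using assms(4) by simp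
  ultimately have "norm (x - x') \<le> l * dist p p'" "\<bar>a - a'\<bar> \<le> l * dist p p'"
    unfolding eq using assms(4) by (auto simp: abs_mult intro: mult_left_le)
  then show thesis using that mem by blast
qed

text \<open>
  A point \<open>(x, g (x, p))\<close> whose value is close to \<open>g0\<close> can be moved into the epigraph at \<open>p0\<close> at a
  cost proportional to \<open>dist p p0\<close>, where the quadratic lower bound is known. Values far above \<open>g0\<close>
  satisfy the bound trivially on a small ball, and values far below are excluded by lower
  semicontinuity. Moving \<open>(x0, g0)\<close> in the opposite direction gives the point \<open>z\<close>.
\<close>
lemma epigraph_lipschitz_bounds:
  fixes g :: "'a::real_inner \<times> 'p::metric_space \<Rightarrow> ereal"
  assumes lsc: "lower_semicontinuous g" and g0: "g (x0, p0) = ereal g0"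
    and low0: "\<forall>x\<in>ball x0 \<rho>. ereal (g0 + v0 \<bullet> (x - x0) - R / 2 * (norm (x - x0))\<^sup>2) \<le> g (x, p0)"
    and "\<rho> > 0" "R \<ge> 0"
    and A3: "lipschitz_like (\<lambda>p. epi (\<lambda>x. g (x, p))) p0 (x0, g0)"
  shows "\<exists>\<delta>>0. \<forall>\<epsilon>>0. \<exists>\<theta>>0. \<forall>p\<in>ball p0 \<theta>.
    (\<forall>x\<in>cball x0 \<delta>. ereal (g0 + v0 \<bullet> (x - x0) - R / 2 * (norm (x - x0))\<^sup>2 - \<epsilon>) \<le> g (x, p)) \<and>
    (\<exists>z\<in>cball x0 \<epsilon>. g (z, p) \<le> ereal (g0 + \<epsilon>))"
proof -
  obtain l U V where l: "l > 0" and U: "open U" "p0 \<in> U" and V: "open V" "(x0, g0) \<in> V"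
    and shift: "\<forall>p\<in>U. \<forall>p'\<in>U. epi (\<lambda>x. g (x, p)) \<inter> V \<subseteq>
        {y + (l * dist p p') *\<^sub>R b | y b. y \<in> epi (\<lambda>x. g (x, p')) \<and> b \<in> cball 0 1}"
    using A3 unfolding lipschitz_like_def by (elim exE conjE)
  note shift = shift[rule_format]
  from open_prod_elim[OF V] obtain V1 V2
    where V12: "open V1" "open V2" "(x0, g0) \<in> V1 \<times> V2" "V1 \<times> V2 \<subseteq> V" .
  from openE[OF V12(1), of x0] V12(3) obtain k1 where k1: "k1 > 0" "ball x0 k1 \<subseteq> V1" by blast
  from openE[OF V12(2), of g0] V12(3) obtain k2 where k2: "k2 > 0" "ball g0 k2 \<subseteq> V2" by blast
  note k = k1 k2
  from openE[OF U] obtain \<upsilon> where \<upsilon>: "\<upsilon> > 0" "ball p0 \<upsilon> \<subseteq> U" .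
  have "ereal (g0 - k2) < g (x0, p0)" using k by (simp add: g0)
  from lower_semicontinuous_nhds[OF lsc this]
  obtain W where W: "open W" "(x0, p0) \<in> W" "\<And>z. z \<in> W \<Longrightarrow> ereal (g0 - k2) < g z"
    unfolding eventually_nhds by blast
  from open_prod_elim[OF W(1,2)] obtain W1 W2
    where W12: "open W1" "open W2" "(x0, p0) \<in> W1 \<times> W2" "W1 \<times> W2 \<subseteq> W" .
  from openE[OF W12(1), of x0] W12(3) obtain b1 where b1: "b1 > 0" "ball x0 b1 \<subseteq> W1" by blast
  from openE[OF W12(2), of p0] W12(3) obtain b2 where b2: "b2 > 0" "ball p0 b2 \<subseteq> W2" by blast
  note b = b1 b2
  define \<delta> where "\<delta> = Min {k1 / 2, \<rho> / 2, b1 / 2, k2 / (norm v0 + 1)}"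
  have n0: "norm v0 + 1 > 0" by (simp add: add_nonneg_pos)
  have \<delta>: "\<delta> > 0" "\<delta> < k1" "\<delta> \<le> \<rho> / 2" "\<delta> < b1" "\<delta> \<le> k2 / (norm v0 + 1)"
  proof -
    show "\<delta> > 0" using k b \<open>\<rho> > 0\<close> n0 by (simp add: \<delta>_def)
    have "\<delta> \<le> k1 / 2" "\<delta> \<le> b1 / 2" unfolding \<delta>_def by (rule Min_le; simp)+
    then show "\<delta> < k1" "\<delta> < b1" using k b by simp_all
    show "\<delta> \<le> \<rho> / 2" "\<delta> \<le> k2 / (norm v0 + 1)" unfolding \<delta>_def by (rule Min_le; simp)+
  qed
  have \<delta>k: "norm v0 * \<delta> \<le> k2"
    using \<delta>(1,5) n0 by (simp add: field_simps)
  show ?thesis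
  proof (rule exI[of _ \<delta>], intro conjI allI impI \<delta>(1))
    fix \<epsilon> :: real assume \<epsilon>: "\<epsilon> > 0"
    define C where "C = l * (1 + norm v0 + R * \<rho>)"
    have C: "C > 0" using l \<open>R \<ge> 0\<close> \<open>\<rho> > 0\<close> unfolding C_def by (intro mult_pos_pos add_pos_nonneg) auto
    define \<theta> where "\<theta> = Min {\<upsilon>, b2, \<rho> / (2 * l), \<epsilon> / C, \<epsilon> / l}"
    have \<theta>: "\<theta> > 0" "\<theta> \<le> \<upsilon>" "\<theta> \<le> b2" "\<theta> \<le> \<rho> / (2 * l)" "\<theta> \<le> \<epsilon> / C" "\<theta> \<le> \<epsilon> / l"
      using \<upsilon> b \<open>\<rho> > 0\<close> l C \<epsilon> by (auto simp: \<theta>_def)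
    have "(\<forall>x\<in>cball x0 \<delta>. ereal (g0 + v0 \<bullet> (x - x0) - R / 2 * (norm (x - x0))\<^sup>2 - \<epsilon>) \<le> g (x, p)) \<and>
        (\<exists>z\<in>cball x0 \<epsilon>. g (z, p) \<le> ereal (g0 + \<epsilon>))" if p: "p \<in> ball p0 \<theta>" for p
    proof
      have pU: "p \<in> U" using p \<theta>(2) \<upsilon> by auto
      define d where "d = dist p p0"
      have d: "0 \<le> d" "d < \<theta>" using p by (auto simp: d_def dist_commute)
      have "l * \<theta> \<le> \<rho> / 2" "C * \<theta> \<le> \<epsilon>" "l * \<theta> \<le> \<epsilon>"
        using \<theta>(4-6) l C by (auto simp: field_simps)
      moreover have "l * d < l * \<theta>" "C * d \<le> C * \<theta>" using d l C by auto
      ultimately have ld: "l * d < \<rho> / 2" "C * d \<le> \<epsilon>" "l * d \<le> \<epsilon>" by linarith+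
      show "\<forall>x\<in>cball x0 \<delta>. ereal (g0 + v0 \<bullet> (x - x0) - R / 2 * (norm (x - x0))\<^sup>2 - \<epsilon>) \<le> g (x, p)"
      proof
        fix x assume x: "x \<in> cball x0 \<delta>"
        have nx: "norm (x - x0) \<le> \<delta>" using x by (simp add: dist_norm norm_minus_commute)
        have gl: "ereal (g0 - k2) < g (x, p)"
          using W(3) W12(4) b \<delta>(4) x p \<theta>(3) by (auto simp: subset_eq)
        show "ereal (g0 + v0 \<bullet> (x - x0) - R / 2 * (norm (x - x0))\<^sup>2 - \<epsilon>) \<le> g (x, p)"
        \<comment> \<open>Above \<open>g0 + k2\<close> the Lipschitz property may say nothing, but \<open>\<delta>\<close> is so small that the bound is below \<open>g0 + k2\<close>.\<close>
        proof (cases "g (x, p) \<ge> ereal (g0 + k2)")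
          case True
          have "v0 \<bullet> (x - x0) \<le> norm v0 * \<delta>"
            by (rule order_trans[OF norm_cauchy_schwarz mult_left_mono]) (use nx in auto)
          moreover have "R / 2 * (norm (x - x0))\<^sup>2 \<ge> 0" using \<open>R \<ge> 0\<close> by simp
          ultimately have "g0 + v0 \<bullet> (x - x0) - R / 2 * (norm (x - x0))\<^sup>2 - \<epsilon> \<le> g0 + k2"
            using \<delta>k \<epsilon> by linarith
          then show ?thesis using True by (meson ereal_less_eq(3) order_trans)
        next
          case False
          then obtain a where a: "g (x, p) = ereal a" "g0 - k2 < a" "a < g0 + k2"
            using gl by (cases "g (x, p)") auto
          have "(x, a) \<in> epi (\<lambda>x. g (x, p))" by (simp add: epi_def a)
          moreover have "(x, a) \<in> V"
          proof -
            have "x \<in> ball x0 k1" using x \<delta>(2) by simp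
            moreover have "a \<in> ball g0 k2" using a(2,3) by (simp add: dist_real_def)
            ultimately show ?thesis using V12(4) k by blast
          qed
          ultimately obtain x' a' where x': "(x', a') \<in> epi (\<lambda>x. g (x, p0))"
            "norm (x - x') \<le> l * d" "\<bar>a - a'\<bar> \<le> l * d"
            using epigraph_lipschitz_shift[OF shift[OF pU U(2)]] l unfolding d_def by (metis less_imp_le)
          have tri: "norm (x' - x0) \<le> norm (x - x0) + l * d"
            using norm_triangle_ineq[of "x' - x" "x - x0"] x'(2) by (simp add: norm_minus_commute)
          then have "x' \<in> ball x0 \<rho>"
            using ld(1) nx \<delta>(3) by (simp add: dist_norm norm_minus_commute)
          moreover have "g (x', p0) \<le> ereal a'" using x'(1) by (simp add: epi_def)
          ultimately have "ereal (g0 + v0 \<bullet> (x' - x0) - R / 2 * (norm (x' - x0))\<^sup>2) \<le> ereal a'"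
            by (rule order_trans[OF bspec[OF low0]])
          then have "g0 + v0 \<bullet> (x' - x0) - R / 2 * (norm (x' - x0))\<^sup>2 \<le> a + l * d"
            using x'(3) by simp
          moreover have "v0 \<bullet> (x - x0) - norm v0 * (l * d) \<le> v0 \<bullet> (x' - x0)"
          proof -
            have "v0 \<bullet> (x - x') \<le> norm v0 * (l * d)"
              by (rule order_trans[OF norm_cauchy_schwarz mult_left_mono]) (use x'(2) in auto)
            then show ?thesis by (simp add: inner_diff_right)
          qed
          moreover have "R / 2 * (norm (x' - x0))\<^sup>2 \<le> R / 2 * ((norm (x - x0))\<^sup>2 + 2 * \<rho> * (l * d))"
          proof (rule mult_left_mono)
            have "(norm (x' - x0))\<^sup>2 \<le> (norm (x - x0) + l * d)\<^sup>2" using tri by (intro power_mono) auto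
            also have "\<dots> = (norm (x - x0))\<^sup>2 + (2 * norm (x - x0) + l * d) * (l * d)"
              by (simp add: power2_eq_square algebra_simps)
            also have "\<dots> \<le> (norm (x - x0))\<^sup>2 + (2 * \<rho>) * (l * d)"
              using nx \<delta>(3) ld(1) d l \<open>\<rho> > 0\<close> by (intro add_left_mono mult_right_mono) auto
            finally show "(norm (x' - x0))\<^sup>2 \<le> (norm (x - x0))\<^sup>2 + 2 * \<rho> * (l * d)" by simp
          qed (use \<open>R \<ge> 0\<close> in simp)
          moreover have "C * d = l * d + norm v0 * (l * d) + R * \<rho> * (l * d)"
            by (simp add: C_def algebra_simps)
          ultimately have "g0 + v0 \<bullet> (x - x0) - R / 2 * (norm (x - x0))\<^sup>2 - \<epsilon> \<le> a"
            using ld(2) by (simp add: algebra_simps)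
          then show ?thesis by (simp add: a(1))
        qed
      qed
      have "(x0, g0) \<in> epi (\<lambda>x. g (x, p0))" by (simp add: epi_def g0)
      then obtain z b where z: "(z, b) \<in> epi (\<lambda>x. g (x, p))" "norm (x0 - z) \<le> l * d" "\<bar>g0 - b\<bar> \<le> l * d"
        using epigraph_lipschitz_shift[OF shift[OF U(2) pU] _ V(2)] l unfolding d_def
        by (metis less_imp_le dist_commute)
      have "g (z, p) \<le> ereal b" using z(1) by (simp add: epi_def)
      also have "ereal b \<le> ereal (g0 + \<epsilon>)" using z(3) ld(3) by simp
      finally have "g (z, p) \<le> ereal (g0 + \<epsilon>)" .
      moreover have "z \<in> cball x0 \<epsilon>" using z ld(3) by (simp add: dist_norm)
      ultimately show "\<exists>z\<in>cball x0 \<epsilon>. g (z, p) \<le> ereal (g0 + \<epsilon>)" by blast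
    qed
    then show "\<exists>\<theta>>0. \<forall>p\<in>ball p0 \<theta>.
        (\<forall>x\<in>cball x0 \<delta>. ereal (g0 + v0 \<bullet> (x - x0) - R / 2 * (norm (x - x0))\<^sup>2 - \<epsilon>) \<le> g (x, p)) \<and>
        (\<exists>z\<in>cball x0 \<epsilon>. g (z, p) \<le> ereal (g0 + \<epsilon>))"
      using \<theta>(1) by blast
  qed
qed

text \<open>
  The bounds of \<open>epigraph_lipschitz_bounds\<close> hold with any prescribed error \<open>\<epsilon>\<close> once \<open>p\<close> is close to \<open>p0\<close>.
  The radius \<open>\<delta>'\<close> is fixed first, so small that solutions and their subgradients stay in the balls of
  radius \<open>\<rho>\<close>; then \<open>\<epsilon>\<close> is chosen according to \<open>\<delta>'\<close>.
\<close>
lemma parametric_resolvent_solvable: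
  fixes g :: "'a::{real_inner,complete_space} \<times> 'p::metric_space \<Rightarrow> ereal"
  assumes proper: "\<And>x p. g (x, p) \<noteq> - \<infinity>" and lsc: "lower_semicontinuous g"
    and v0: "v0 \<in> partial_subdiff g x0 p0"
    and A3: "lipschitz_like (\<lambda>p. epi (\<lambda>x. g (x, p))) p0 (x0, real_of_ereal (g (x0, p0)))"
    and P: "\<forall>p\<in>ball p0 \<rho>. prox_inequality_on (\<lambda>x. g (x, p)) x0 v0 R \<rho>"
    and \<rho>: "\<rho> > 0" and \<sigma>: "0 \<le> R" "R < \<sigma>"
  shows "\<exists>\<theta>>0. \<forall>p\<in>ball p0 \<theta>. \<forall>y\<in>ball v0 \<theta>. \<exists>x\<in>ball x0 \<rho>.
    y - \<sigma> *\<^sub>R (x - x0) \<in> ball v0 \<rho> \<and> y - \<sigma> *\<^sub>R (x - x0) \<in> partial_subdiff g x p"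
proof -
  define g0 where "g0 = real_of_ereal (g (x0, p0))"
  have g0: "g (x0, p0) = ereal g0"
    using partial_subdiff_finite[OF v0] by (cases "g (x0, p0)") (auto simp: g0_def)
  have low0: "\<forall>x\<in>ball x0 \<rho>. ereal (g0 + v0 \<bullet> (x - x0) - R / 2 * (norm (x - x0))\<^sup>2) \<le> g (x, p0)"
  proof
    fix x assume "x \<in> ball x0 \<rho>"
    then show "ereal (g0 + v0 \<bullet> (x - x0) - R / 2 * (norm (x - x0))\<^sup>2) \<le> g (x, p0)"
      using prox_inequality_onD[OF bspec[OF P], of p0 x0 v0 x] \<rho> v0 by (simp add: g0 partial_subdiff_def add_diff_eq)
  qed
  obtain \<delta> where \<delta>: "\<delta> > 0" and unif: "\<forall>\<epsilon>>0. \<exists>\<theta>>0. \<forall>p\<in>ball p0 \<theta>.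
    (\<forall>x\<in>cball x0 \<delta>. ereal (g0 + v0 \<bullet> (x - x0) - R / 2 * (norm (x - x0))\<^sup>2 - \<epsilon>) \<le> g (x, p)) \<and>
    (\<exists>z\<in>cball x0 \<epsilon>. g (z, p) \<le> ereal (g0 + \<epsilon>))"
    using epigraph_lipschitz_bounds[OF lsc g0 low0 \<rho> \<sigma>(1) A3[folded g0_def]] by (elim exE conjE)
  define \<delta>' where "\<delta>' = Min {\<delta>, \<rho> / 4, \<rho> / (4 * \<sigma>)}"
  have \<sigma>0: "\<sigma> > 0" using \<sigma> by simp
  have \<delta>': "\<delta>' > 0" "\<delta>' \<le> \<delta>" "\<delta>' \<le> \<rho> / 4" "\<delta>' \<le> \<rho> / (4 * \<sigma>)"
    using \<delta> \<rho> \<sigma>0 by (auto simp: \<delta>'_def)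
  then have \<sigma>\<delta>: "\<sigma> * \<delta>' \<le> \<rho> / 4" using \<sigma>0 by (simp add: field_simps)
  define K where "K = 3 + norm v0 + \<sigma> + \<delta>"
  have K: "K > 0" using \<sigma>0 \<delta> by (simp add: K_def add_pos_pos add_pos_nonneg)
  define \<epsilon> where "\<epsilon> = Min {1, \<delta>, \<rho> / 4, (\<sigma> - R) * \<delta>'\<^sup>2 / (4 * K)}"
  have \<epsilon>: "\<epsilon> > 0" "\<epsilon> \<le> 1" "\<epsilon> \<le> \<delta>" "\<epsilon> \<le> \<rho> / 4" "\<epsilon> \<le> (\<sigma> - R) * \<delta>'\<^sup>2 / (4 * K)"
    using \<delta> \<delta>'(1) \<rho> \<sigma> K by (auto simp: \<epsilon>_def)
  have "\<epsilon> * K \<le> (\<sigma> - R) * \<delta>'\<^sup>2 / 4" using \<epsilon>(5) K by (simp add: field_simps)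
  moreover have "(\<sigma> - R) * \<delta>'\<^sup>2 > 0" using \<sigma> \<delta>'(1) by simp
  ultimately have small: "\<epsilon> * (3 + norm v0 + \<sigma> + \<delta>) < (\<sigma> - R) / 2 * \<delta>'\<^sup>2" unfolding K_def by simp
  from unif \<epsilon>(1) obtain \<theta> where \<theta>: "\<theta> > 0" and near: "\<forall>p\<in>ball p0 \<theta>.
    (\<forall>x\<in>cball x0 \<delta>. ereal (g0 + v0 \<bullet> (x - x0) - R / 2 * (norm (x - x0))\<^sup>2 - \<epsilon>) \<le> g (x, p)) \<and>
    (\<exists>z\<in>cball x0 \<epsilon>. g (z, p) \<le> ereal (g0 + \<epsilon>))" by meson
  have "\<exists>x\<in>ball x0 \<rho>. y - \<sigma> *\<^sub>R (x - x0) \<in> ball v0 \<rho> \<and> y - \<sigma> *\<^sub>R (x - x0) \<in> partial_subdiff g x p"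
    if p: "p \<in> ball p0 (min (min \<theta> \<rho>) \<epsilon>)" and y: "y \<in> ball v0 (min (min \<theta> \<rho>) \<epsilon>)" for p y
  proof -
    have "p \<in> ball p0 \<theta>" using p by simp
    from bspec[OF near this] obtain z
      where low: "\<forall>x\<in>cball x0 \<delta>. ereal (g0 + v0 \<bullet> (x - x0) - R / 2 * (norm (x - x0))\<^sup>2 - \<epsilon>) \<le> g (x, p)"
      and z: "z \<in> cball x0 \<epsilon>" "g (z, p) \<le> ereal (g0 + \<epsilon>)" by blast
    have Pp: "prox_inequality_on (\<lambda>x. g (x, p)) x0 v0 R \<rho>" using p by (intro bspec[OF P]) simp
    have ny: "norm (y - v0) \<le> \<epsilon>" using y by (simp add: dist_norm norm_minus_commute)
    have num: "\<delta>' < \<rho> / 2" "\<epsilon> + \<sigma> * \<delta>' < \<rho>" using \<delta>' \<sigma>\<delta> \<epsilon> \<rho> by auto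
    obtain x where x: "norm (x - x0) \<le> \<delta>'" "y - \<sigma> *\<^sub>R (x - x0) \<in> limiting_subdiff (\<lambda>x. g (x, p)) x"
      using resolvent_solvable[OF lower_semicontinuous_section[OF lsc] proper Pp \<sigma> bspec[OF low] z \<epsilon>(1-3) \<delta>'(1,2) num small ny]
      by blast
    have "norm (y - \<sigma> *\<^sub>R (x - x0) - v0) \<le> norm (y - v0) + norm (\<sigma> *\<^sub>R (x - x0))"
      using norm_triangle_ineq4[of "y - v0" "\<sigma> *\<^sub>R (x - x0)"] by (simp add: algebra_simps)
    also have "\<dots> \<le> \<epsilon> + \<sigma> * \<delta>'" using ny x(1) \<sigma>0 by (intro add_mono) auto
    finally have "y - \<sigma> *\<^sub>R (x - x0) \<in> ball v0 \<rho>" using num(2) by (simp add: dist_norm norm_minus_commute)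
    moreover have "x \<in> ball x0 \<rho>" using x(1) num(1) \<rho> by (simp add: dist_norm norm_minus_commute)
    ultimately show ?thesis using x(2) by (auto simp: partial_subdiff_def)
  qed
  moreover have "min (min \<theta> \<rho>) \<epsilon> > 0" using \<theta> \<rho> \<epsilon>(1) by simp
  ultimately show ?thesis by blast
qed

section \<open>The local resolvent\<close>

text \<open>
  The map \<open>y \<mapsto> x\<close> solving \<open>y \<in> \<partial>\<phi>(x) + \<sigma> (x - x0)\<close>. The second conjunct makes the graph of \<open>J\<close> the
  whole local graph of \<open>\<partial>\<phi>\<close> in the new coordinates, which is what allows normals to the one
  graph to be read as normals to the other.
\<close>
definition local_resolvent ::
    "('a::real_inner \<Rightarrow> ereal) \<Rightarrow> 'a \<Rightarrow> 'a \<Rightarrow> real \<Rightarrow> real \<Rightarrow> real \<Rightarrow> ('a \<Rightarrow> 'a) \<Rightarrow> bool" where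
  "local_resolvent \<phi> x0 v0 \<sigma> \<rho> \<theta> J \<longleftrightarrow>
     (\<forall>y\<in>ball v0 \<theta>. J y \<in> ball x0 \<rho> \<and> y - \<sigma> *\<^sub>R (J y - x0) \<in> ball v0 \<rho> \<and>
        y - \<sigma> *\<^sub>R (J y - x0) \<in> limiting_subdiff \<phi> (J y)) \<and>
     (\<forall>u\<in>ball x0 \<rho>. \<forall>v\<in>ball v0 \<rho>. v \<in> limiting_subdiff \<phi> u \<longrightarrow>
        v + \<sigma> *\<^sub>R (u - x0) \<in> ball v0 \<theta> \<longrightarrow> J (v + \<sigma> *\<^sub>R (u - x0)) = u)"

lemma local_resolventD:
  assumes "local_resolvent \<phi> x0 v0 \<sigma> \<rho> \<theta> J" "y \<in> ball v0 \<theta>"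
  shows "J y \<in> ball x0 \<rho>" "y - \<sigma> *\<^sub>R (J y - x0) \<in> ball v0 \<rho>" "y - \<sigma> *\<^sub>R (J y - x0) \<in> limiting_subdiff \<phi> (J y)"
  using assms unfolding local_resolvent_def by blast+

lemma local_resolvent_eq:
  assumes "local_resolvent \<phi> x0 v0 \<sigma> \<rho> \<theta> J" "u \<in> ball x0 \<rho>" "v \<in> ball v0 \<rho>" "v \<in> limiting_subdiff \<phi> u"
    "v + \<sigma> *\<^sub>R (u - x0) \<in> ball v0 \<theta>"
  shows "J (v + \<sigma> *\<^sub>R (u - x0)) = u"
  using assms unfolding local_resolvent_def by blast

lemma resolvent_inner_shift:
  fixes u u' v v' x0 :: "'a::real_inner"
  shows "((v + \<sigma> *\<^sub>R (u - x0)) - (v' + \<sigma> *\<^sub>R (u' - x0))) \<bullet> (u - u') =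
    (v - v') \<bullet> (u - u') + \<sigma> * (norm (u - u'))\<^sup>2"
  by (simp add: power2_norm_eq_inner inner_diff_left inner_diff_right inner_add_left algebra_simps)

lemma norm_resolvent_argument_le:
  fixes v v0 x x0 :: "'a::real_normed_vector"
  assumes "0 \<le> \<sigma>"
  shows "norm (v + \<sigma> *\<^sub>R (x - x0) - v0) \<le> norm (v - v0) + \<sigma> * norm (x - x0)"
proof -
  have eq: "v + \<sigma> *\<^sub>R (x - x0) - v0 = (v - v0) + \<sigma> *\<^sub>R (x - x0)" by simp
  show ?thesis
    unfolding eq using norm_triangle_ineq[of "v - v0" "\<sigma> *\<^sub>R (x - x0)"] assms by simp
qed

lemma local_resolvent_exists:
  assumes P: "prox_inequality_on \<phi> x0 v0 R \<rho>" and \<sigma>: "R < \<sigma>"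
    and solv: "\<forall>y\<in>ball v0 \<theta>. \<exists>x\<in>ball x0 \<rho>. y - \<sigma> *\<^sub>R (x - x0) \<in> ball v0 \<rho> \<and>
      y - \<sigma> *\<^sub>R (x - x0) \<in> limiting_subdiff \<phi> x"
  obtains J where "local_resolvent \<phi> x0 v0 \<sigma> \<rho> \<theta> J"
proof -
  from bchoice[OF solv[unfolded Bex_def]] obtain J where J: "\<forall>y\<in>ball v0 \<theta>. J y \<in> ball x0 \<rho> \<and>
      y - \<sigma> *\<^sub>R (J y - x0) \<in> ball v0 \<rho> \<and> y - \<sigma> *\<^sub>R (J y - x0) \<in> limiting_subdiff \<phi> (J y)" by blast
  have "J (v + \<sigma> *\<^sub>R (u - x0)) = u"
    if u: "u \<in> ball x0 \<rho>" "v \<in> ball v0 \<rho>" "v \<in> limiting_subdiff \<phi> u" and y: "v + \<sigma> *\<^sub>R (u - x0) \<in> ball v0 \<theta>" for u v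
  proof -
    define y where "y = v + \<sigma> *\<^sub>R (u - x0)"
    define v' where "v' = y - \<sigma> *\<^sub>R (J y - x0)"
    have "J y \<in> ball x0 \<rho>" "v' \<in> ball v0 \<rho>" "v' \<in> limiting_subdiff \<phi> (J y)"
      using bspec[OF J y] by (simp_all add: y_def v'_def)
    from prox_inequality_imp_hypomonotone[OF P u this]
    have "- R * (norm (u - J y))\<^sup>2 \<le> (v - v') \<bullet> (u - J y)" .
    also have "\<dots> = - \<sigma> * (norm (u - J y))\<^sup>2"
      using resolvent_inner_shift[of v \<sigma> u x0 v' "J y"] by (simp add: v'_def y_def)
    finally have "(\<sigma> - R) * (norm (u - J y))\<^sup>2 \<le> 0" by (simp add: algebra_simps)
    then show ?thesis using \<sigma> by (simp add: mult_le_0_iff y_def)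
  qed
  then have "local_resolvent \<phi> x0 v0 \<sigma> \<rho> \<theta> J" using J unfolding local_resolvent_def by blast
  then show thesis by (rule that)
qed

lemma local_resolvent_cocoercive:
  assumes P: "prox_inequality_on \<phi> x0 v0 R \<rho>" and J: "local_resolvent \<phi> x0 v0 \<sigma> \<rho> \<theta> J"
    and y: "y \<in> ball v0 \<theta>" and y': "y' \<in> ball v0 \<theta>"
  shows "(\<sigma> - R) * (norm (J y - J y'))\<^sup>2 \<le> (y - y') \<bullet> (J y - J y')"
  using prox_inequality_imp_hypomonotone[OF P local_resolventD[OF J y] local_resolventD[OF J y']]
    resolvent_inner_shift[of "y - \<sigma> *\<^sub>R (J y - x0)" \<sigma> "J y" x0 "y' - \<sigma> *\<^sub>R (J y' - x0)" "J y'"]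
  by (simp add: algebra_simps)

text \<open>
  Completing the square. It is used for increments of the resolvent and also for the pair of dual
  vectors, which is how primal and dual bounds meet with the same constant.
\<close>
lemma cocoercive_iff_nonexpansive:
  fixes a b :: "'a::real_inner"
  assumes "\<kappa> > 0"
  shows "\<kappa> * (norm b)\<^sup>2 \<le> a \<bullet> b \<longleftrightarrow> norm ((2 * \<kappa>) *\<^sub>R b - a) \<le> norm a"
proof -
  have "(norm ((2 * \<kappa>) *\<^sub>R b - a))\<^sup>2 = 4 * \<kappa> * (\<kappa> * (norm b)\<^sup>2 - a \<bullet> b) + (norm a)\<^sup>2"
    unfolding power2_norm_eq_inner by (simp add: inner_diff_left inner_diff_right inner_commute algebra_simps)
  moreover have "norm ((2 * \<kappa>) *\<^sub>R b - a) \<le> norm a \<longleftrightarrow> (norm ((2 * \<kappa>) *\<^sub>R b - a))\<^sup>2 \<le> (norm a)\<^sup>2"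
    by (simp add: norm_le_square power2_norm_eq_inner norm_le)
  moreover have "4 * \<kappa> * (\<kappa> * (norm b)\<^sup>2 - a \<bullet> b) \<le> 0 \<longleftrightarrow> \<kappa> * (norm b)\<^sup>2 - a \<bullet> b \<le> 0"
    using assms by (simp add: mult_le_0_iff)
  ultimately show ?thesis by auto
qed

lemma cocoercive_imp_lipschitz:
  fixes a b :: "'a::real_inner"
  assumes "\<kappa> > 0" "\<kappa> * (norm b)\<^sup>2 \<le> a \<bullet> b"
  shows "norm b \<le> norm a / \<kappa>"
proof (cases "b = 0")
  case False
  have "\<kappa> * (norm b)\<^sup>2 \<le> norm a * norm b" by (rule order_trans[OF assms(2) norm_cauchy_schwarz])
  then have "\<kappa> * norm b \<le> norm a" using False by (simp add: power2_eq_square mult.assoc[symmetric])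
  then show ?thesis using assms(1) by (simp add: field_simps)
qed (use assms in simp)

section \<open>From prox-regularity to the coderivative\<close>

text \<open>
  In resolvent coordinates the normal cone inequality reads
  \<open>\<langle>a, \<Delta>x\<rangle> - \<langle>w, \<Delta>y\<rangle> \<le> o(\<parallel>\<Delta>y\<parallel>)\<close> with \<open>a = z + \<sigma> w\<close>. Take \<open>\<Delta>y = t d\<close>
  and write \<open>2\<kappa> \<Delta>x = t d + q\<close>, where \<open>\<parallel>q\<parallel> \<le> t \<parallel>d\<parallel>\<close> by
  nonexpansiveness. Then \<open>t \<langle>a - 2\<kappa>w, d\<rangle> \<le> t \<parallel>a\<parallel> \<parallel>d\<parallel> + o(t)\<close>, and the choice
  \<open>d = a - 2\<kappa>w\<close> gives \<open>\<parallel>a - 2\<kappa>w\<parallel> \<le> \<parallel>a\<parallel>\<close>, the dual form of the claim.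
\<close>
lemma prox_inequality_imp_coderivative_ge:
  fixes \<phi> :: "'a::real_inner \<Rightarrow> ereal"
  assumes P: "prox_inequality_on \<phi> x0 v0 R \<rho>" and J: "local_resolvent \<phi> x0 v0 \<sigma> \<rho> \<theta> J"
    and \<sigma>: "0 \<le> R" "R < \<sigma>"
    and x: "x \<in> ball x0 \<rho>" and v: "v \<in> ball v0 \<rho>" and y: "v + \<sigma> *\<^sub>R (x - x0) \<in> ball v0 \<theta>"
    and z: "z \<in> regular_coderivative (limiting_subdiff \<phi>) x v w"
  shows "- R * (norm w)\<^sup>2 \<le> z \<bullet> w"
proof -
  have lim: "v \<in> limiting_subdiff \<phi> x" using z by (simp add: regular_coderivative_iff)
  define \<kappa> where "\<kappa> = \<sigma> - R"
  have \<kappa>: "\<kappa> > 0" using \<sigma> by (simp add: \<kappa>_def)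
  define a where "a = z + \<sigma> *\<^sub>R w"
  define d where "d = a - (2 * \<kappa>) *\<^sub>R w"
  define y0 where "y0 = v + \<sigma> *\<^sub>R (x - x0)"
  have y0: "y0 \<in> ball v0 \<theta>" using y by (simp add: y0_def)
  have Jy0: "J y0 = x" unfolding y0_def by (rule local_resolvent_eq[OF J x v lim y])
  \<comment> \<open>\<open>X t\<close> and \<open>W t\<close> are the increments of \<open>x\<close> and \<open>v\<close> when \<open>y0\<close> moves to \<open>y0 + t d\<close>.\<close>
  define X where "X t = J (y0 + t *\<^sub>R d) - x" for t
  define W where "W t = t *\<^sub>R d - \<sigma> *\<^sub>R X t" for t
  define C where "C = norm d / \<kappa> + (norm d + \<sigma> * (norm d / \<kappa>))"
  have C: "C \<ge> 0" using \<kappa> \<sigma> by (simp add: C_def)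
  have "(\<lambda>t. y0 + t *\<^sub>R d) \<midarrow>0\<rightarrow> y0 + 0 *\<^sub>R d" by (intro tendsto_intros)
  then have "((\<lambda>t. y0 + t *\<^sub>R d) \<longlongrightarrow> y0) (at_right 0)" by (simp add: filterlim_at_split)
  then have evb: "\<forall>\<^sub>F t in at_right 0. y0 + t *\<^sub>R d \<in> ball v0 \<theta>"
    using y0 by (rule topological_tendstoD[OF _ open_ball])
  have pos: "\<forall>\<^sub>F t in at_right (0::real). t > 0" by (simp add: eventually_at_right_less)
  have est: "norm (X t) \<le> t * (norm d / \<kappa>)" "norm (W t) \<le> t * (norm d + \<sigma> * (norm d / \<kappa>))"
    "norm ((2 * \<kappa>) *\<^sub>R X t - t *\<^sub>R d) \<le> t * norm d" "v + W t \<in> limiting_subdiff \<phi> (x + X t)"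
    if t: "t > 0" "y0 + t *\<^sub>R d \<in> ball v0 \<theta>" for t
  proof -
    have co: "\<kappa> * (norm (X t))\<^sup>2 \<le> (t *\<^sub>R d) \<bullet> X t"
      using local_resolvent_cocoercive[OF P J t(2) y0] by (simp add: Jy0 X_def \<kappa>_def)
    show 1: "norm (X t) \<le> t * (norm d / \<kappa>)" using cocoercive_imp_lipschitz[OF \<kappa> co] t by simp
    show "norm ((2 * \<kappa>) *\<^sub>R X t - t *\<^sub>R d) \<le> t * norm d"
      using cocoercive_iff_nonexpansive[OF \<kappa>, of "X t" "t *\<^sub>R d"] co t by simp
    have "norm (W t) \<le> norm (t *\<^sub>R d) + norm (\<sigma> *\<^sub>R X t)" unfolding W_def by (rule norm_triangle_ineq4)
    also have "\<dots> \<le> t * norm d + \<sigma> * (t * (norm d / \<kappa>))"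
      using mult_left_mono[OF 1, of \<sigma>] t \<sigma> by simp
    finally show "norm (W t) \<le> t * (norm d + \<sigma> * (norm d / \<kappa>))" by (simp add: algebra_simps)
    have "v + W t = y0 + t *\<^sub>R d - \<sigma> *\<^sub>R (J (y0 + t *\<^sub>R d) - x0)"
      by (simp add: W_def X_def y0_def algebra_simps)
    then show "v + W t \<in> limiting_subdiff \<phi> (x + X t)"
      using local_resolventD(3)[OF J t(2)] by (simp add: X_def)
  qed
  have tlim: "((\<lambda>t. t * c) \<longlongrightarrow> 0) (at_right 0)" for c :: real
    by (rule tendsto_eq_intros | simp)+
  have X0: "(X \<longlongrightarrow> 0) (at_right 0)"
    by (rule Lim_null_comparison[OF _ tlim]) (use evb pos in eventually_elim, rule est(1))
  have W0: "(W \<longlongrightarrow> 0) (at_right 0)"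
    by (rule Lim_null_comparison[OF _ tlim]) (use evb pos in eventually_elim, rule est(2))
  have lim_xv: "((\<lambda>t. (x + X t, v + W t)) \<longlongrightarrow> (x, v)) (at_right 0)"
    using tendsto_Pair[OF tendsto_add[OF tendsto_const X0, of x] tendsto_add[OF tendsto_const W0, of v]] by simp
  have ineq: "(norm d)\<^sup>2 \<le> norm a * norm d + 2 * \<kappa> * C * e" if e: "e > 0" for e
  proof -
    from z e have "\<forall>\<^sub>F (x', v') in nhds (x, v). v' \<in> limiting_subdiff \<phi> x' \<longrightarrow>
       z \<bullet> (x' - x) - w \<bullet> (v' - v) \<le> e * norm (x' - x, v' - v)"
      by (simp add: regular_coderivative_iff)
    from eventually_compose_filterlim[OF this lim_xv]
    have "\<forall>\<^sub>F t in at_right 0. v + W t \<in> limiting_subdiff \<phi> (x + X t) \<longrightarrow>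
       z \<bullet> X t - w \<bullet> W t \<le> e * norm (X t, W t)" by simp
    with evb pos have "\<forall>\<^sub>F t in at_right (0::real). (norm d)\<^sup>2 \<le> norm a * norm d + 2 * \<kappa> * C * e"
    proof eventually_elim
      case (elim t)
      have t: "t > 0" "y0 + t *\<^sub>R d \<in> ball v0 \<theta>" using elim by auto
      have "norm (X t, W t) \<le> norm (X t) + norm (W t)" by (rule norm_Pair_le)
      also have "\<dots> \<le> t * C" using est(1,2)[OF t] by (simp add: C_def distrib_left)
      finally have "z \<bullet> X t - w \<bullet> W t \<le> e * (t * C)"
        using elim(3) est(4)[OF t] e by (meson less_imp_le mult_left_mono order_trans)
      then have 1: "a \<bullet> X t - t * (w \<bullet> d) \<le> e * (t * C)"
        by (simp add: W_def a_def inner_diff_right inner_add_left)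
      define G where "G = (2 * \<kappa>) *\<^sub>R X t - t *\<^sub>R d"
      have "- (norm a * (t * norm d)) \<le> a \<bullet> G"
        using Cauchy_Schwarz_ineq2[of a G] mult_left_mono[OF est(3)[OF t], of "norm a"] by (simp add: G_def abs_le_iff)
      moreover have "2 * \<kappa> * (a \<bullet> X t) = a \<bullet> G + t * (a \<bullet> d)" by (simp add: G_def inner_diff_right)
      moreover have "2 * \<kappa> * (a \<bullet> X t - t * (w \<bullet> d)) \<le> 2 * \<kappa> * (e * (t * C))"
        using 1 \<kappa> by (intro mult_left_mono) auto
      moreover have "t * (a \<bullet> d) - 2 * \<kappa> * (t * (w \<bullet> d)) = t * (norm d)\<^sup>2"
        by (simp add: d_def power2_norm_eq_inner inner_diff_left inner_diff_right inner_commute algebra_simps)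
      ultimately have "t * (norm d)\<^sup>2 \<le> t * (norm a * norm d + 2 * \<kappa> * C * e)" by (simp add: algebra_simps)
      then show ?case using t(1) by simp
    qed
    then show ?thesis by (simp add: eventually_const_iff)
  qed
  have "(norm d)\<^sup>2 \<le> norm a * norm d"
  proof (rule field_le_epsilon)
    fix e :: real assume e: "e > 0"
    define M where "M = 2 * \<kappa> * C"
    have M: "M \<ge> 0" using \<kappa> C by (simp add: M_def)
    have "M * (e / (M + 1)) \<le> e" using M e by (simp add: field_simps)
    then show "(norm d)\<^sup>2 \<le> norm a * norm d + e" using ineq[of "e / (M + 1)"] M e unfolding M_def[symmetric] by simp
  qed
  then have "norm d \<le> norm a"
    by (cases "d = 0") (auto simp: power2_eq_square)
  then have "\<kappa> * (norm w)\<^sup>2 \<le> a \<bullet> w"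
    using cocoercive_iff_nonexpansive[OF \<kappa>, of w a] by (simp add: d_def norm_minus_commute)
  then show ?thesis by (simp add: a_def \<kappa>_def inner_add_left power2_norm_eq_inner algebra_simps)
qed

section \<open>From the coderivative to prox-regularity\<close>

text \<open>
  A regular subgradient \<open>c = 2\<kappa>b - a\<close> of \<open>\<langle>a, G(\<cdot>)\<rangle>\<close> yields the element \<open>\<sigma> b - a\<close> of the coderivative of
  \<open>\<partial>\<phi>\<close> at \<open>- b\<close>, because nearby points of the graph of \<open>\<partial>\<phi>\<close> are values of the resolvent. The
  assumed bound then says \<open>\<parallel>c\<parallel> \<le> \<parallel>a\<parallel>\<close>. Hence \<open>\<langle>a, G(\<cdot>)\<rangle>\<close> is \<open>\<parallel>a\<parallel>\<close>-Lipschitz for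
  every \<open>a\<close>, and \<open>a = G y - G y'\<close> shows that \<open>G\<close> is nonexpansive. The constant \<open>R\<close> makes
  the resolvent Lipschitz to begin with, and the mean value argument starts from there.
\<close>
lemma coderivative_bound_imp_cocoercive:
  fixes \<phi> :: "'a::{real_inner,complete_space} \<Rightarrow> ereal"
  assumes P: "prox_inequality_on \<phi> x0 v0 R \<rho>" and J: "local_resolvent \<phi> x0 v0 \<sigma> \<rho> \<theta> J"
    and \<sigma>: "0 < \<sigma>" "R < \<sigma>" "r < \<sigma>"
    and cod: "\<And>x v z w. x \<in> ball x0 \<rho> \<Longrightarrow> v \<in> ball v0 \<rho> \<Longrightarrow>
      z \<in> regular_coderivative (limiting_subdiff \<phi>) x v w \<Longrightarrow> - r * (norm w)\<^sup>2 \<le> z \<bullet> w"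
    and y: "y \<in> ball v0 (\<theta> / 2)" and y': "y' \<in> ball v0 (\<theta> / 2)"
  shows "(\<sigma> - r) * (norm (J y - J y'))\<^sup>2 \<le> (y - y') \<bullet> (J y - J y')"
proof -
  define \<kappa> where "\<kappa> = \<sigma> - r"
  have \<kappa>: "\<kappa> > 0" using \<sigma> by (simp add: \<kappa>_def)
  define G where "G y = (2 * \<kappa>) *\<^sub>R J y - y" for y
  have J_lip: "norm (J y - J y') \<le> norm (y - y') / (\<sigma> - R)"
    if "y \<in> ball v0 \<theta>" "y' \<in> ball v0 \<theta>" for y y'
    using cocoercive_imp_lipschitz[OF _ local_resolvent_cocoercive[OF P J that]] \<sigma> by simp
  define K where "K = 2 * \<kappa> / (\<sigma> - R) + 1"
  have K: "K \<ge> 0" using \<kappa> \<sigma> by (simp add: K_def)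
  have G_lip: "norm (G y - G y') \<le> K * norm (y - y')"
    if "y \<in> ball v0 \<theta>" "y' \<in> ball v0 \<theta>" for y y'
  proof -
    have "G y - G y' = (2 * \<kappa>) *\<^sub>R (J y - J y') - (y - y')" by (simp add: G_def algebra_simps)
    then have "norm (G y - G y') \<le> norm ((2 * \<kappa>) *\<^sub>R (J y - J y')) + norm (y - y')"
      by (metis norm_triangle_ineq4)
    also have "norm ((2 * \<kappa>) *\<^sub>R (J y - J y')) \<le> 2 * \<kappa> * (norm (y - y') / (\<sigma> - R))"
      using mult_left_mono[OF J_lip[OF that], of "2 * \<kappa>"] \<kappa> by simp
    finally show ?thesis by (simp add: K_def distrib_right)
  qed
  have sub_bound: "norm c \<le> norm a"
    if y: "y \<in> ball v0 \<theta>" and c: "c \<in> regular_subdiff (\<lambda>y. ereal (a \<bullet> G y)) y" for a c y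
  proof -
    define b where "b = (1 / (2 * \<kappa>)) *\<^sub>R (c + a)"
    have c_eq: "c = (2 * \<kappa>) *\<^sub>R b - a" using \<kappa> by (simp add: b_def)
    define x where "x = J y"
    define v where "v = y - \<sigma> *\<^sub>R (x - x0)"
    have xv: "x \<in> ball x0 \<rho>" "v \<in> ball v0 \<rho>" "v \<in> limiting_subdiff \<phi> x"
      using local_resolventD[OF J y] by (simp_all add: x_def v_def)
    have "\<sigma> *\<^sub>R b - a \<in> regular_coderivative (limiting_subdiff \<phi>) x v (- b)"
      unfolding regular_coderivative_iff
    proof (intro conjI allI impI xv(3))
      fix e :: real assume e: "e > 0"
      \<comment> \<open>Chosen to undo the factor \<open>2 * \<kappa>\<close> and the bound \<open>1 + \<sigma>\<close> on the change of variables.\<close>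
      define e' where "e' = 2 * \<kappa> * e / (1 + \<sigma>)"
      have e': "e' > 0" "e' * (1 + \<sigma>) = 2 * \<kappa> * e" using e \<kappa> \<sigma> by (auto simp: e'_def)
      have "\<forall>\<^sub>F u in at y. ereal (a \<bullet> G y) + ereal (c \<bullet> (u - y) - e' * norm (u - y)) \<le> ereal (a \<bullet> G u)"
        using c e'(1) unfolding regular_subdiff_iff by blast
      then have ev: "\<forall>\<^sub>F u in nhds y. a \<bullet> G y + c \<bullet> (u - y) - e' * norm (u - y) \<le> a \<bullet> G u"
        unfolding eventually_at_filter by (rule eventually_mono) auto
      have "((\<lambda>q. snd q + \<sigma> *\<^sub>R (fst q - x0)) \<longlongrightarrow> snd (x, v) + \<sigma> *\<^sub>R (fst (x, v) - x0)) (nhds (x, v))"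
        by (intro tendsto_intros filterlim_ident)
      then have fl: "((\<lambda>q. snd q + \<sigma> *\<^sub>R (fst q - x0)) \<longlongrightarrow> y) (nhds (x, v))" by (simp add: v_def)
      have "\<forall>\<^sub>F q in nhds (x, v). q \<in> ball x0 \<rho> \<times> ball v0 \<rho>"
        using xv(1,2) by (intro eventually_nhds_in_open open_Times) auto
      moreover have "\<forall>\<^sub>F q in nhds (x, v). snd q + \<sigma> *\<^sub>R (fst q - x0) \<in> ball v0 \<theta>"
        using fl y by (rule topological_tendstoD[OF _ open_ball])
      ultimately show "\<forall>\<^sub>F (x', v') in nhds (x, v). v' \<in> limiting_subdiff \<phi> x' \<longrightarrow>
          (\<sigma> *\<^sub>R b - a) \<bullet> (x' - x) - (- b) \<bullet> (v' - v) \<le> e * norm (x' - x, v' - v)"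
        using eventually_compose_filterlim[OF ev fl]
      proof eventually_elim
        case (elim q)
        obtain x' v' where q: "q = (x', v')" by (cases q)
        have "(\<sigma> *\<^sub>R b - a) \<bullet> (x' - x) - (- b) \<bullet> (v' - v) \<le> e * norm (x' - x, v' - v)"
          if v': "v' \<in> limiting_subdiff \<phi> x'"
        proof -
          define u where "u = v' + \<sigma> *\<^sub>R (x' - x0)"
          have Ju: "J u = x'" unfolding u_def using elim v' by (intro local_resolvent_eq[OF J]) (auto simp: q)
          have u_diff: "u - y = (v' - v) + \<sigma> *\<^sub>R (x' - x)" by (simp add: u_def v_def algebra_simps)
          have "norm (u - y) \<le> norm (v' - v) + \<sigma> * norm (x' - x)"
            unfolding u_diff using norm_triangle_ineq[of "v' - v" "\<sigma> *\<^sub>R (x' - x)"] \<sigma> by simp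
          also have "\<dots> \<le> (1 + \<sigma>) * norm (x' - x, v' - v)"
            unfolding distrib_right mult_1
            by (intro add_mono mult_left_mono norm_snd_le norm_fst_le) (use \<sigma> in simp)
          finally have "e' * norm (u - y) \<le> e' * ((1 + \<sigma>) * norm (x' - x, v' - v))"
            using e'(1) by (intro mult_left_mono) auto
          then have "e' * norm (u - y) \<le> 2 * \<kappa> * (e * norm (x' - x, v' - v))"
            using e'(2) by (simp add: mult.assoc[symmetric])
          moreover have "a \<bullet> G y + c \<bullet> (u - y) - e' * norm (u - y) \<le> a \<bullet> G u"
            using elim(3) by (simp add: q u_def)
          then have "2 * \<kappa> * (b \<bullet> (u - y) - a \<bullet> (x' - x)) \<le> e' * norm (u - y)"
            by (simp add: c_eq G_def Ju x_def[symmetric] inner_diff_left inner_diff_right algebra_simps)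
          ultimately have "2 * \<kappa> * (b \<bullet> (u - y) - a \<bullet> (x' - x)) \<le> 2 * \<kappa> * (e * norm (x' - x, v' - v))"
            by simp
          then have "b \<bullet> (u - y) - a \<bullet> (x' - x) \<le> e * norm (x' - x, v' - v)"
            using \<kappa> by simp
          then show ?thesis
            unfolding u_diff by (simp add: inner_diff_left inner_add_right)
        qed
        then show ?case by (simp add: q)
      qed
    qed
    from cod[OF xv(1,2) this] have "\<kappa> * (norm b)\<^sup>2 \<le> a \<bullet> b"
      by (simp add: \<kappa>_def inner_diff_left power2_norm_eq_inner algebra_simps)
    then show ?thesis using cocoercive_iff_nonexpansive[OF \<kappa>, of b a] by (simp add: c_eq)
  qed
  have "a \<bullet> G y - a \<bullet> G y' \<le> norm a * norm (y - y')" for a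
  proof (rule regular_subgradient_bound_imp_lipschitz[OF _ _ norm_ge_zero sub_bound y y'])
    show "\<bar>a \<bullet> G y - a \<bullet> G y'\<bar> \<le> (norm a * K) * norm (y - y')"
      if "y \<in> ball v0 \<theta>" "y' \<in> ball v0 \<theta>" for y y'
      using order_trans[OF Cauchy_Schwarz_ineq2[of a "G y - G y'"] mult_left_mono[OF G_lip[OF that]]]
      by (simp add: inner_diff_right mult.assoc)
  qed (use K in auto)
  from this[of "G y - G y'"] have "(norm (G y - G y'))\<^sup>2 \<le> norm (G y - G y') * norm (y - y')"
    by (simp add: power2_norm_eq_inner inner_diff_right)
  then have "norm (G y - G y') \<le> norm (y - y')"
    by (cases "G y = G y'") (auto simp: power2_eq_square)
  moreover have "G y - G y' = (2 * \<kappa>) *\<^sub>R (J y - J y') - (y - y')" by (simp add: G_def algebra_simps)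
  ultimately show ?thesis
    using cocoercive_iff_nonexpansive[OF \<kappa>, of "J y - J y'" "y - y'"] by (simp add: \<kappa>_def)
qed

text \<open>
  Let \<open>q(z) = r1/2 \<parallel>z - u\<parallel>\<^sup>2 + M \<parallel>z - u\<parallel>\<^sup>4 - \<langle>v, z - u\<rangle>\<close> with \<open>r' < r1 < r\<close>. A minimiser \<open>z\<close> of
  \<open>\<phi> + q\<close> carries a subgradient \<open>v'\<close> with \<open>v' - v = -(r1 + 4M \<parallel>z - u\<parallel>\<^sup>2) (z - u)\<close>, and since \<open>r1 > r'\<close>
  hypomonotonicity permits this only for \<open>z = u\<close>; with errors tending to \<open>0\<close> the minimisers tend to
  \<open>u\<close>. So \<open>\<phi> + q\<close> is minimal at \<open>u\<close>. The quartic term keeps the minimiser off the sphere of radius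
  \<open>m\<close>, where the inequality known so far has only the constant \<open>R\<close>, possibly larger than
  \<open>r\<close>; on the smaller ball of radius \<open>s\<close> around \<open>x0\<close> it is dominated by \<open>(r - r1)/2 \<parallel>z - u\<parallel>\<^sup>2\<close>.
\<close>
lemma hypomonotone_imp_prox_inequality:
  fixes \<phi> :: "'a::{real_inner,complete_space} \<Rightarrow> ereal"
  assumes lsc: "lower_semicontinuous \<phi>" and proper: "\<And>x. \<phi> x \<noteq> - \<infinity>"
    and P: "prox_inequality_on \<phi> x0 v0 R \<rho>" and R: "0 \<le> R" and r: "0 \<le> r'" "r' < r"
    and hypo: "\<And>u v u' v'. u \<in> ball x0 \<rho> \<Longrightarrow> v \<in> ball v0 \<rho> \<Longrightarrow> v \<in> limiting_subdiff \<phi> u \<Longrightarrow>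
      u' \<in> ball x0 \<rho> \<Longrightarrow> v' \<in> ball v0 \<rho> \<Longrightarrow> v' \<in> limiting_subdiff \<phi> u' \<Longrightarrow>
      - r' * (norm (u - u'))\<^sup>2 \<le> (v - v') \<bullet> (u - u')"
    and m: "0 < m" and s: "0 < s" "s + (1 + r + 4 * (R + 1)) * m < \<rho>"
    and sm: "2 * s \<le> m" "4 * (R + 1) * s\<^sup>2 \<le> (r - r') / 4 * m\<^sup>2"
  shows "prox_inequality_on \<phi> x0 v0 r s"
  unfolding prox_inequality_on_def
proof (intro ballI impI)
  fix u v x assume u: "u \<in> ball x0 s" and v: "v \<in> ball v0 s" and lim: "v \<in> limiting_subdiff \<phi> u" and x: "x \<in> ball x0 s"
  define r1 where "r1 = (r + r') / 2"
  have r1: "0 \<le> r1" "r' < r1" "r1 \<le> r" using r by (auto simp: r1_def)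
  \<comment> \<open>On the sphere of radius \<open>m\<close> the quartic term is \<open>(R + 1) m\<^sup>2\<close>, more than the defect \<open>R/2 m\<^sup>2\<close>.\<close>
  define M where "M = (R + 1) / m\<^sup>2"
  have M: "M > 0" "M * m\<^sup>2 = R + 1" using R m by (auto simp: M_def)
  have "1 * m \<le> (1 + r + 4 * (R + 1)) * m" using r R m by (intro mult_right_mono) auto
  then have s\<rho>: "s + m < \<rho>" "s < \<rho>" using s m by linarith+
  have u\<rho>: "u \<in> ball x0 \<rho>" and v\<rho>: "v \<in> ball v0 \<rho>" using u v s\<rho> by auto
  have cb: "z \<in> ball x0 \<rho>" if "z \<in> cball u m" for z
    using that u s\<rho>(1) dist_triangle[of x0 z u] by simp
  obtain fu where fu: "\<phi> u = ereal fu" using limiting_subdiff_finite[OF lim] by auto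
  define q where "q z = r1 / 2 * ((z - u) \<bullet> (z - u)) + M * ((z - u) \<bullet> (z - u))\<^sup>2 - v \<bullet> (z - u)" for z
  have qc: "continuous_on UNIV q" unfolding q_def by (intro continuous_intros)
  have qd: "(q has_derivative (\<lambda>h. ((r1 + 4 * M * (norm (z - u))\<^sup>2) *\<^sub>R (z - u) - v) \<bullet> h)) (at z)" for z
    unfolding q_def
    by (auto intro!: derivative_eq_intros simp: fun_eq_iff inner_diff_left inner_diff_right inner_add_left
        inner_commute power2_norm_eq_inner algebra_simps)
  have q_u: "q u = 0" by (simp add: q_def)
  have u0: "u \<in> cball u m" "\<phi> u < \<infinity>" using m fu by auto
  have low: "ereal (fu + M * ((norm (z - u))\<^sup>2)\<^sup>2 - R / 2 * (norm (z - u))\<^sup>2) \<le> \<phi> z + ereal (q z)"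
    if z: "z \<in> cball u m" for z
  proof -
    have "fu + (v \<bullet> (z - u) - R / 2 * (norm (z - u))\<^sup>2) + q z \<ge> fu + M * ((norm (z - u))\<^sup>2)\<^sup>2 - R / 2 * (norm (z - u))\<^sup>2"
      using r1(1) by (simp add: q_def power2_norm_eq_inner)
    moreover have "ereal (fu + (v \<bullet> (z - u) - R / 2 * (norm (z - u))\<^sup>2)) \<le> \<phi> z"
      using prox_inequality_onD[OF P u\<rho> v\<rho> lim cb[OF z]] by (simp add: fu)
    ultimately show ?thesis by (cases "\<phi> z") auto
  qed
  have lb: "ereal (fu - R / 2 * m\<^sup>2) \<le> \<phi> z + ereal (q z)" if z: "z \<in> cball u m" for z
  proof (rule order_trans[OF _ low[OF z]])
    have "(norm (z - u))\<^sup>2 \<le> m\<^sup>2" using z by (intro power_mono) (auto simp: dist_norm norm_minus_commute)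
    then have "R / 2 * (norm (z - u))\<^sup>2 \<le> R / 2 * m\<^sup>2" using R by (intro mult_left_mono) auto
    moreover have "M * ((norm (z - u))\<^sup>2)\<^sup>2 \<ge> 0" using M(1) by simp
    ultimately show "ereal (fu - R / 2 * m\<^sup>2) \<le> ereal (fu + M * ((norm (z - u))\<^sup>2)\<^sup>2 - R / 2 * (norm (z - u))\<^sup>2)" by simp
  qed
  have inner: "z \<in> ball u m" if z: "z \<in> cball u m" and le: "\<phi> z + ereal (q z) \<le> \<phi> u + ereal (q u)" for z
  proof (rule ccontr)
    assume "z \<notin> ball u m"
    then have n: "norm (z - u) = m" using z by (simp add: dist_norm norm_minus_commute)
    have "fu + M * (m\<^sup>2)\<^sup>2 - R / 2 * m\<^sup>2 \<le> fu"
      using order_trans[OF low[OF z] le] by (simp add: n fu q_u)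
    then have "(M * m\<^sup>2) * m\<^sup>2 \<le> R / 2 * m\<^sup>2" by (simp add: power2_eq_square[of "m\<^sup>2"] mult.assoc)
    then have "R + 1 \<le> R / 2" unfolding M(2) using m by (simp only: mult_le_cancel_right) auto
    then show False using R by simp
  qed
  have approx: "\<exists>z. z \<in> ball u m \<and> norm (z - u) \<le> m / (r1 - r') / real (Suc n) \<and>
     \<phi> z + ereal (q z) \<le> \<phi> x + ereal (q x + m / real (Suc n) * (norm (x - z) + (norm (x - z))\<^sup>2))" for n
  proof -
    define \<eta> where "\<eta> = m / real (Suc n)"
    have \<eta>: "\<eta> > 0" "\<eta> \<le> m" using m by (auto simp: \<eta>_def field_simps)
    obtain z e where z: "z \<in> ball u m" "norm e \<le> \<eta>"
      and sub: "\<And>w. (q has_derivative (\<lambda>h. w \<bullet> h)) (at z) \<Longrightarrow> e - w \<in> regular_subdiff \<phi> z"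
      and min: "\<And>x. x \<in> cball u m \<Longrightarrow> \<phi> z + ereal (q z) \<le> \<phi> x + ereal (q x + \<eta> * norm (x - z) + \<eta> * (norm (x - z))\<^sup>2)"
      by (rule perturbed_minimum[OF lsc proper qc u0 lb inner \<eta>(1)]; (assumption | (rule that; assumption)))
    define N where "N = norm (z - u)"
    have N: "0 \<le> N" "N < m" using z(1) by (auto simp: N_def dist_norm norm_minus_commute)
    define c where "c = r1 + 4 * M * N\<^sup>2"
    define v' where "v' = v + e - c *\<^sub>R (z - u)"
    have "e - ((r1 + 4 * M * (norm (z - u))\<^sup>2) *\<^sub>R (z - u) - v) \<in> limiting_subdiff \<phi> z"
      using sub[OF qd] regular_subset_limiting by blast
    then have v'lim: "v' \<in> limiting_subdiff \<phi> z" by (simp add: v'_def c_def N_def algebra_simps)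
    have "M * N\<^sup>2 \<le> M * m\<^sup>2" using M(1) N by (intro mult_left_mono power_mono) auto
    then have c: "r1 \<le> c" "c \<le> r + 4 * (R + 1)" using M r1(3) by (auto simp: c_def)
    have "norm (v' - v) \<le> norm e + norm (c *\<^sub>R (z - u))"
      using norm_triangle_ineq4[of e "c *\<^sub>R (z - u)"] by (simp add: v'_def)
    also have "norm (c *\<^sub>R (z - u)) \<le> (r + 4 * (R + 1)) * m"
      using c r1(1) N by (auto simp: N_def[symmetric] intro!: mult_mono)
    finally have "norm (v' - v) \<le> (1 + r + 4 * (R + 1)) * m" using z(2) \<eta>(2) by (simp add: algebra_simps)
    moreover have "norm (v' - v0) \<le> norm (v' - v) + norm (v - v0)"
      using norm_triangle_ineq[of "v' - v" "v - v0"] by simp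
    moreover have "norm (v - v0) < s" using v by (simp add: dist_norm norm_minus_commute)
    ultimately have v'\<rho>: "v' \<in> ball v0 \<rho>" using s(2) by (simp add: dist_norm norm_minus_commute)
    have z\<rho>: "z \<in> ball x0 \<rho>" using z(1) by (intro cb) simp
    have "- r' * N\<^sup>2 \<le> (v' - v) \<bullet> (z - u)"
      unfolding N_def by (rule hypo[OF z\<rho> v'\<rho> v'lim u\<rho> v\<rho> lim])
    also have "\<dots> = e \<bullet> (z - u) - c * N\<^sup>2"
      by (simp add: v'_def N_def power2_norm_eq_inner inner_diff_left inner_diff_right algebra_simps)
    also have "\<dots> \<le> \<eta> * N - r1 * N\<^sup>2"
    proof (rule diff_mono)
      show "e \<bullet> (z - u) \<le> \<eta> * N"
        unfolding N_def by (rule order_trans[OF norm_cauchy_schwarz mult_right_mono]) (use z(2) in auto)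
      show "r1 * N\<^sup>2 \<le> c * N\<^sup>2" using c(1) by (intro mult_right_mono) auto
    qed
    finally have "((r1 - r') * N) * N \<le> \<eta> * N" by (simp add: power2_eq_square algebra_simps)
    then have "(r1 - r') * N \<le> \<eta>"
      using N(1) \<eta>(1) by (cases "N = 0") (auto dest: mult_right_le_imp_le)
    then have "N \<le> \<eta> / (r1 - r')" using r1(2) by (simp add: pos_le_divide_eq mult.commute)
    then have "norm (z - u) \<le> m / (r1 - r') / real (Suc n)" by (simp add: N_def \<eta>_def mult.commute)
    moreover have "x \<in> cball u m" using u x sm(1) dist_triangle[of u x x0] by (simp add: dist_commute)
    from min[OF this] have "\<phi> z + ereal (q z) \<le> \<phi> x + ereal (q x + m / real (Suc n) * (norm (x - z) + (norm (x - z))\<^sup>2))"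
      by (simp add: \<eta>_def distrib_left add.assoc)
    ultimately show ?thesis using z(1) by blast
  qed
  then obtain zs where zs: "\<And>n. zs n \<in> ball u m" "\<And>n. norm (zs n - u) \<le> m / (r1 - r') / real (Suc n)"
    and zs_min: "\<And>n. \<phi> (zs n) + ereal (q (zs n)) \<le>
        \<phi> x + ereal (q x + m / real (Suc n) * (norm (x - zs n) + (norm (x - zs n))\<^sup>2))"
    by metis
  have tozero: "(\<lambda>n. c / real (Suc n)) \<longlonglongrightarrow> 0" for c :: real
    using tendsto_mult_left[OF LIMSEQ_inverse_real_of_nat, of c] by (simp add: divide_inverse)
  have "(\<lambda>n. zs n - u) \<longlonglongrightarrow> 0"
    by (rule Lim_null_comparison[OF always_eventually tozero], rule allI, rule zs(2))
  then have zlim: "zs \<longlonglongrightarrow> u" by (simp add: LIM_zero_iff)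
  have "q x \<le> r / 2 * (norm (x - u))\<^sup>2 - v \<bullet> (x - u)"
  proof -
    have nx: "norm (x - u) \<le> 2 * s" using u x dist_triangle[of u x x0] by (simp add: dist_commute dist_norm norm_minus_commute)
    have "M * (2 * s)\<^sup>2 \<le> (r - r1) / 2"
    proof -
      have "M * (2 * s)\<^sup>2 * m\<^sup>2 = 4 * (R + 1) * s\<^sup>2" using m by (simp add: M_def power_mult_distrib)
      also have "\<dots> \<le> (r - r1) / 2 * m\<^sup>2" using sm(2) by (simp add: r1_def field_simps)
      finally show ?thesis using m by simp
    qed
    moreover have "M * (norm (x - u))\<^sup>2 \<le> M * (2 * s)\<^sup>2" using M(1) nx by (intro mult_left_mono power_mono) auto
    ultimately have "(M * (norm (x - u))\<^sup>2) * (norm (x - u))\<^sup>2 \<le> (r - r1) / 2 * (norm (x - u))\<^sup>2"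
      by (intro mult_right_mono) auto
    then show ?thesis by (simp add: q_def power2_norm_eq_inner[symmetric] power2_eq_square[of "(norm (x - u))\<^sup>2"] algebra_simps diff_divide_distrib)
  qed
  moreover have "\<phi> u \<le> \<phi> x + ereal (q x)"
  proof (cases "\<phi> x")
    case (real fx)
    have "(\<lambda>n. fx + (q x + m / real (Suc n) * (norm (x - zs n) + (norm (x - zs n))\<^sup>2)) - q (zs n))
        \<longlonglongrightarrow> fx + (q x + 0 * (norm (x - u) + (norm (x - u))\<^sup>2)) - q u"
      by (intro tendsto_intros tozero zlim continuous_on_tendsto_compose[OF qc zlim]) auto
    moreover have "\<phi> (zs n) \<le> ereal (fx + (q x + m / real (Suc n) * (norm (x - zs n) + (norm (x - zs n))\<^sup>2)) - q (zs n))" for n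
      using zs_min[of n] unfolding real by (cases "\<phi> (zs n)") auto
    ultimately have "\<phi> u \<le> ereal (fx + (q x + 0 * (norm (x - u) + (norm (x - u))\<^sup>2)) - q u)"
      by (rule lower_semicontinuous_seq[OF lsc zlim])
    then show ?thesis by (simp add: real q_u)
  qed (use proper in auto)
  ultimately show "\<phi> u + ereal (v \<bullet> (x - u) - r / 2 * (norm (x - u))\<^sup>2) \<le> \<phi> x"
    using proper[of x] by (cases "\<phi> x") (auto simp: fu)
qed

section \<open>The two bounds for the threshold\<close>

lemma coderivative_bound_ge_iff:
  "ereal c \<le> coderivative_bound g x0 p0 v0 \<eta> \<longleftrightarrow>
    (\<forall>p\<in>cball p0 \<eta>. \<forall>x\<in>cball x0 \<eta>. \<forall>v\<in>cball v0 \<eta>. \<forall>z w.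
       z \<in> regular_coderivative (limiting_subdiff (\<lambda>u. g (u, p))) x v w \<longrightarrow> c * (norm w)\<^sup>2 \<le> z \<bullet> w)"
proof -
  have D: "(\<lambda>u. partial_subdiff g u p) = limiting_subdiff (\<lambda>u. g (u, p))" for p
    by (simp add: partial_subdiff_def fun_eq_iff)
  have gph: "(x, p, v) \<in> gph_partial_subdiff g"
    if "z \<in> regular_coderivative (limiting_subdiff (\<lambda>u. g (u, p))) x v w" for x p v z w
    using that by (simp add: regular_coderivative_iff gph_partial_subdiff_def partial_subdiff_def)
  have quot: "c \<le> (z \<bullet> w) / (norm w)\<^sup>2 \<longleftrightarrow> c * (norm w)\<^sup>2 \<le> z \<bullet> w" if "w \<noteq> 0" for z w :: 'a
    using that by (simp add: pos_le_divide_eq)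
  show ?thesis
  proof
    assume L: "ereal c \<le> coderivative_bound g x0 p0 v0 \<eta>"
    show "\<forall>p\<in>cball p0 \<eta>. \<forall>x\<in>cball x0 \<eta>. \<forall>v\<in>cball v0 \<eta>. \<forall>z w.
       z \<in> regular_coderivative (limiting_subdiff (\<lambda>u. g (u, p))) x v w \<longrightarrow> c * (norm w)\<^sup>2 \<le> z \<bullet> w"
    proof (intro ballI allI impI)
      fix p x v z w assume b: "p \<in> cball p0 \<eta>" "x \<in> cball x0 \<eta>" "v \<in> cball v0 \<eta>"
        and z: "z \<in> regular_coderivative (limiting_subdiff (\<lambda>u. g (u, p))) x v w"
      show "c * (norm w)\<^sup>2 \<le> z \<bullet> w"
      proof (cases "w = 0")
        case False
        have "coderivative_bound g x0 p0 v0 \<eta> \<le> ereal ((z \<bullet> w) / (norm w)\<^sup>2)"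
          unfolding coderivative_bound_def D
          by (rule Inf_lower, rule CollectI) (use b z gph[OF z] False in blast)
        with L have "ereal c \<le> ereal ((z \<bullet> w) / (norm w)\<^sup>2)" by (rule order_trans)
        then show ?thesis using quot[OF False] by simp
      qed simp
    qed
  next
    assume R: "\<forall>p\<in>cball p0 \<eta>. \<forall>x\<in>cball x0 \<eta>. \<forall>v\<in>cball v0 \<eta>. \<forall>z w.
       z \<in> regular_coderivative (limiting_subdiff (\<lambda>u. g (u, p))) x v w \<longrightarrow> c * (norm w)\<^sup>2 \<le> z \<bullet> w"
    show "ereal c \<le> coderivative_bound g x0 p0 v0 \<eta>"
      unfolding coderivative_bound_def D
    proof (rule Inf_greatest)
      fix s assume "s \<in> {ereal ((z \<bullet> w) / (norm w)\<^sup>2) | x p v z w.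
            z \<in> regular_coderivative (limiting_subdiff (\<lambda>u. g (u, p))) x v w \<and>
            (x, p, v) \<in> gph_partial_subdiff g \<inter> (cball x0 \<eta> \<times> cball p0 \<eta> \<times> cball v0 \<eta>) \<and> w \<noteq> 0}"
      then obtain x p v z w where s: "s = ereal ((z \<bullet> w) / (norm w)\<^sup>2)"
        and z: "z \<in> regular_coderivative (limiting_subdiff (\<lambda>u. g (u, p))) x v w"
        and b: "x \<in> cball x0 \<eta>" "p \<in> cball p0 \<eta>" "v \<in> cball v0 \<eta>" and w: "w \<noteq> 0"
        by blast
      show "ereal c \<le> s" using R[rule_format, OF b(2,1,3) z] quot[OF w] by (simp add: s)
    qed
  qed
qed

lemma coderivative_limit_ge:
  assumes "\<eta> > 0"
  shows "coderivative_bound g x0 p0 v0 \<eta> \<le> coderivative_limit g x0 p0 v0"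
proof (rule tendsto_lowerbound[OF coderivative_limit_tendsto])
  show "\<forall>\<^sub>F \<eta>' in at_right 0. coderivative_bound g x0 p0 v0 \<eta> \<le> coderivative_bound g x0 p0 v0 \<eta>'"
    unfolding eventually_at_right_field
    using assms by (intro exI[of _ \<eta>]) (auto intro: coderivative_bound_antimono)
qed simp

lemma coderivative_limit_greaterD:
  assumes "c < coderivative_limit g x0 p0 v0"
  obtains \<eta> where "\<eta> > 0" "c < coderivative_bound g x0 p0 v0 \<eta>"
proof -
  have "\<forall>\<^sub>F \<eta> in at_right 0. c < coderivative_bound g x0 p0 v0 \<eta>"
    using order_tendstoD(1)[OF coderivative_limit_tendsto assms] .
  then obtain b :: real where "b > 0" "\<forall>y>0. y < b \<longrightarrow> c < coderivative_bound g x0 p0 v0 y"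
    unfolding eventually_at_right_field by auto
  then show thesis using that[of "b / 2"] by simp
qed

lemma prox_inequality_imp_coderivative_bound:
  fixes g :: "'a::{real_inner,complete_space} \<times> 'p::metric_space \<Rightarrow> ereal"
  assumes proper: "\<And>x p. g (x, p) \<noteq> - \<infinity>" and lsc: "lower_semicontinuous g"
    and v0: "v0 \<in> partial_subdiff g x0 p0"
    and A3: "lipschitz_like (\<lambda>p. epi (\<lambda>x. g (x, p))) p0 (x0, real_of_ereal (g (x0, p0)))"
    and P: "\<forall>p\<in>ball p0 \<rho>. prox_inequality_on (\<lambda>x. g (x, p)) x0 v0 R \<rho>"
    and \<rho>: "\<rho> > 0" and R: "0 \<le> R"
  shows "\<exists>\<eta>>0. ereal (- R) \<le> coderivative_bound g x0 p0 v0 \<eta>"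
proof -
  define \<sigma> where "\<sigma> = R + 1"
  have \<sigma>: "R < \<sigma>" "0 < \<sigma>" using R by (auto simp: \<sigma>_def)
  obtain \<theta> where \<theta>: "\<theta> > 0" and solv: "\<forall>p\<in>ball p0 \<theta>. \<forall>y\<in>ball v0 \<theta>. \<exists>x\<in>ball x0 \<rho>.
      y - \<sigma> *\<^sub>R (x - x0) \<in> ball v0 \<rho> \<and> y - \<sigma> *\<^sub>R (x - x0) \<in> partial_subdiff g x p"
    using parametric_resolvent_solvable[OF proper lsc v0 A3 P \<rho> R \<sigma>(1)] by (elim exE conjE)
  define \<eta> where "\<eta> = min (\<rho> / 2) (\<theta> / (2 * (1 + \<sigma>)))"
  have \<eta>: "\<eta> > 0" using \<rho> \<theta> \<sigma> by (simp add: \<eta>_def)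
  have "\<eta> \<le> \<theta> / (2 * (1 + \<sigma>))" by (simp add: \<eta>_def)
  then have "(1 + \<sigma>) * \<eta> \<le> \<theta> / 2" using \<sigma> by (simp add: field_simps)
  moreover have "\<eta> \<le> (1 + \<sigma>) * \<eta>" using \<eta> \<sigma> by simp
  moreover have "\<eta> \<le> \<rho> / 2" unfolding \<eta>_def by (rule min.cobounded1)
  ultimately have \<eta>': "\<eta> < \<rho>" "\<eta> < \<theta>" "(1 + \<sigma>) * \<eta> < \<theta>" using \<rho> \<theta> by linarith+
  have "- R * (norm w)\<^sup>2 \<le> z \<bullet> w"
    if b: "p \<in> cball p0 \<eta>" "x \<in> cball x0 \<eta>" "v \<in> cball v0 \<eta>"
      and z: "z \<in> regular_coderivative (limiting_subdiff (\<lambda>u. g (u, p))) x v w" for p x v z w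
  proof -
    have p: "p \<in> ball p0 \<rho>" "p \<in> ball p0 \<theta>" and xv: "x \<in> ball x0 \<rho>" "v \<in> ball v0 \<rho>"
      using b \<eta>' by auto
    have "norm (v + \<sigma> *\<^sub>R (x - x0) - v0) \<le> norm (v - v0) + \<sigma> * norm (x - x0)"
      using \<sigma> by (intro norm_resolvent_argument_le) simp
    also have "\<dots> \<le> \<eta> + \<sigma> * \<eta>"
      using b \<sigma> by (intro add_mono mult_left_mono) (auto simp: dist_norm norm_minus_commute)
    finally have y: "v + \<sigma> *\<^sub>R (x - x0) \<in> ball v0 \<theta>"
      using \<eta>'(3) by (simp add: dist_norm norm_minus_commute distrib_right)
    obtain J where J: "local_resolvent (\<lambda>x. g (x, p)) x0 v0 \<sigma> \<rho> \<theta> J"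
      by (rule local_resolvent_exists[OF bspec[OF P p(1)] \<sigma>(1) bspec[OF solv p(2), unfolded partial_subdiff_def]])
    show ?thesis
      by (rule prox_inequality_imp_coderivative_ge[OF bspec[OF P p(1)] J R \<sigma>(1) xv y z])
  qed
  then show ?thesis unfolding coderivative_bound_ge_iff using \<eta> by blast
qed

text \<open>
  The inequality with some constant \<open>R\<close> is improved to every constant above \<open>r'\<close>. The radii are nested:
  \<open>\<rho>1\<close> lies in the range of the coderivative bound, \<open>\<rho>2\<close> maps under \<open>(x, v) \<mapsto> v + \<sigma> (x - x0)\<close> into
  the ball of radius \<open>\<theta> / 2\<close> on which the resolvent is cocoercive with the improved constant, and \<open>s\<close> is
  a fraction of \<open>m\<close>, the radius of the minimisation, which is itself a fraction of \<open>\<rho>2\<close>.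
\<close>
lemma coderivative_bound_imp_prox_inequality:
  fixes g :: "'a::{real_inner,complete_space} \<times> 'p::metric_space \<Rightarrow> ereal"
  assumes proper: "\<And>x p. g (x, p) \<noteq> - \<infinity>" and lsc: "lower_semicontinuous g"
    and v0: "v0 \<in> partial_subdiff g x0 p0"
    and A3: "lipschitz_like (\<lambda>p. epi (\<lambda>x. g (x, p))) p0 (x0, real_of_ereal (g (x0, p0)))"
    and P: "\<forall>p\<in>ball p0 \<rho>. prox_inequality_on (\<lambda>x. g (x, p)) x0 v0 R \<rho>"
    and \<rho>: "\<rho> > 0" and R: "0 \<le> R"
    and cod: "\<eta> > 0" "ereal (- r') \<le> coderivative_bound g x0 p0 v0 \<eta>" and r: "0 \<le> r'" "r' < r"
  shows "\<exists>s>0. \<forall>p\<in>ball p0 s. prox_inequality_on (\<lambda>x. g (x, p)) x0 v0 r s"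
proof -
  define \<sigma> where "\<sigma> = R + r' + 1"
  have \<sigma>: "R < \<sigma>" "r' < \<sigma>" "0 < \<sigma>" using R r by (auto simp: \<sigma>_def)
  define \<rho>1 where "\<rho>1 = min \<rho> \<eta>"
  have \<rho>1: "\<rho>1 > 0" "\<rho>1 \<le> \<rho>" "\<rho>1 \<le> \<eta>" using \<rho> cod(1) by (auto simp: \<rho>1_def)
  have P1: "\<forall>p\<in>ball p0 \<rho>1. prox_inequality_on (\<lambda>x. g (x, p)) x0 v0 R \<rho>1"
    using P \<rho>1(2) by (auto intro: prox_inequality_on_mono)
  obtain \<theta> where \<theta>: "\<theta> > 0" and solv: "\<forall>p\<in>ball p0 \<theta>. \<forall>y\<in>ball v0 \<theta>. \<exists>x\<in>ball x0 \<rho>1.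
      y - \<sigma> *\<^sub>R (x - x0) \<in> ball v0 \<rho>1 \<and> y - \<sigma> *\<^sub>R (x - x0) \<in> partial_subdiff g x p"
    using parametric_resolvent_solvable[OF proper lsc v0 A3 P1 \<rho>1(1) R \<sigma>(1)] by (elim exE conjE)
  define \<rho>2 where "\<rho>2 = min \<rho>1 (\<theta> / (2 * (1 + \<sigma>)))"
  have \<rho>2: "\<rho>2 > 0" "\<rho>2 \<le> \<rho>1" using \<rho>1 \<theta> \<sigma> by (auto simp: \<rho>2_def)
  have "\<rho>2 \<le> \<theta> / (2 * (1 + \<sigma>))" by (simp add: \<rho>2_def)
  then have \<rho>2': "(1 + \<sigma>) * \<rho>2 \<le> \<theta> / 2" using \<sigma> by (simp add: field_simps)
  define A where "A = 1 + r + 4 * (R + 1)"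
  define m where "m = \<rho>2 / (4 * A)"
  have A: "A > 0" using R r by (simp add: A_def)
  have m: "m > 0" "A * m = \<rho>2 / 4" using \<rho>2 A by (auto simp: m_def)
  define c where "c = min (1 / 2) ((r - r') / (16 * (R + 1)))"
  have c: "c > 0" "c \<le> 1 / 2" "c \<le> (r - r') / (16 * (R + 1))"
    unfolding c_def by (use r R in simp, rule min.cobounded1, rule min.cobounded2)
  define s where "s = min (c * m) (\<rho>2 / 2)"
  have s: "s > 0" "s \<le> c * m" "s \<le> \<rho>2 / 2"
    unfolding s_def by (use c m \<rho>2 in simp, rule min.cobounded1, rule min.cobounded2)
  have sA: "s + (1 + r + 4 * (R + 1)) * m < \<rho>2" using s m(2) \<rho>2(1) unfolding A_def by linarith
  have "c * m \<le> 1 / 2 * m" using c(2) m(1) by (intro mult_right_mono) auto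
  then have sm: "2 * s \<le> m" using s(2) by linarith
  have sm2: "4 * (R + 1) * s\<^sup>2 \<le> (r - r') / 4 * m\<^sup>2"
  proof -
    have "s\<^sup>2 \<le> (c * m)\<^sup>2" using s by (intro power_mono) auto
    also have "\<dots> \<le> c * m\<^sup>2"
      using c by (simp add: power_mult_distrib power2_eq_square[of c] mult_left_le_one_le)
    finally have "4 * (R + 1) * s\<^sup>2 \<le> 4 * (R + 1) * (c * m\<^sup>2)" using R by (intro mult_left_mono) auto
    also have "\<dots> = (4 * (R + 1) * c) * m\<^sup>2" by simp
    also have "\<dots> \<le> (r - r') / 4 * m\<^sup>2" using c(3) R by (intro mult_right_mono) (auto simp: field_simps)
    finally show ?thesis .
  qed
  have "prox_inequality_on (\<lambda>x. g (x, p)) x0 v0 r s" if p: "p \<in> ball p0 (min \<rho>1 \<theta>)" for p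
  proof -
    have p1: "p \<in> ball p0 \<rho>1" and p2: "p \<in> ball p0 \<theta>" using p by auto
    obtain J where J: "local_resolvent (\<lambda>x. g (x, p)) x0 v0 \<sigma> \<rho>1 \<theta> J"
      by (rule local_resolvent_exists[OF bspec[OF P1 p1] \<sigma>(1) bspec[OF solv p2, unfolded partial_subdiff_def]])
    have codp: "- r' * (norm w)\<^sup>2 \<le> z \<bullet> w"
      if "x \<in> ball x0 \<rho>1" "v \<in> ball v0 \<rho>1" "z \<in> regular_coderivative (limiting_subdiff (\<lambda>x. g (x, p))) x v w" for x v z w
      using cod(2)[unfolded coderivative_bound_ge_iff, rule_format, OF _ _ _ that(3)] that(1,2) p1 \<rho>1(3) by auto
    have hypo: "- r' * (norm (u - u'))\<^sup>2 \<le> (v - v') \<bullet> (u - u')"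
      if u: "u \<in> ball x0 \<rho>2" "v \<in> ball v0 \<rho>2" "v \<in> limiting_subdiff (\<lambda>x. g (x, p)) u"
        and u': "u' \<in> ball x0 \<rho>2" "v' \<in> ball v0 \<rho>2" "v' \<in> limiting_subdiff (\<lambda>x. g (x, p)) u'" for u v u' v'
    proof -
      have y: "v + \<sigma> *\<^sub>R (u - x0) \<in> ball v0 (\<theta> / 2)" if "u \<in> ball x0 \<rho>2" "v \<in> ball v0 \<rho>2" for u v
      proof -
        have "norm (v + \<sigma> *\<^sub>R (u - x0) - v0) \<le> norm (v - v0) + \<sigma> * norm (u - x0)"
          using \<sigma> by (intro norm_resolvent_argument_le) simp
        also have "\<dots> < \<rho>2 + \<sigma> * \<rho>2"
          using that \<sigma> by (intro add_strict_mono mult_strict_left_mono) (auto simp: dist_norm norm_minus_commute)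
        finally show ?thesis using \<rho>2' by (simp add: dist_norm norm_minus_commute distrib_right)
      qed
      have Jy: "J (v + \<sigma> *\<^sub>R (u - x0)) = u"
        if "u \<in> ball x0 \<rho>2" "v \<in> ball v0 \<rho>2" "v \<in> limiting_subdiff (\<lambda>x. g (x, p)) u" for u v
        using y[OF that(1,2)] that \<rho>2(2) \<theta> by (intro local_resolvent_eq[OF J]) auto
      from coderivative_bound_imp_cocoercive[OF bspec[OF P1 p1] J \<sigma>(3,1,2) codp y[OF u(1,2)] y[OF u'(1,2)]]
      show ?thesis
        unfolding Jy[OF u] Jy[OF u'] resolvent_inner_shift by (simp add: algebra_simps)
    qed
    show ?thesis
      by (rule hypomonotone_imp_prox_inequality[OF lower_semicontinuous_section[OF lsc] proper
            prox_inequality_on_mono[OF bspec[OF P1 p1] \<rho>2(2)] R r hypo m(1) s(1) sA sm sm2])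
  qed
  then have "prox_inequality_on (\<lambda>x. g (x, p)) x0 v0 r (min s (min \<rho>1 \<theta>))"
    if "p \<in> ball p0 (min s (min \<rho>1 \<theta>))" for p
    using that by (intro prox_inequality_on_mono[OF _ min.cobounded1]) simp
  moreover have "min s (min \<rho>1 \<theta>) > 0" using s(1) \<rho>1(1) \<theta> by simp
  ultimately show ?thesis by blast
qed

theorem theorem5p3:
  fixes f :: "'a::{real_inner,complete_space} \<times> 'p::metric_space \<times> 'q::metric_space \<Rightarrow> 'a"
    and g :: "'a \<times> 'p \<Rightarrow> ereal"
    and xbar vbar vhat :: 'a and pbar :: 'p and qbar :: 'q
    and \<tau> :: ereal
  assumes "\<forall>x p. g (x, p) \<noteq> - \<infinity>"
    and "lower_semicontinuous g"
    and "vbar \<in> (\<lambda>v. f (xbar, pbar, qbar) + v) ` partial_subdiff g xbar pbar"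
    and "vhat = vbar - f (xbar, pbar, qbar)"
    and A2: "param_cont_prox_regular g xbar pbar vhat"
    and A3: "lipschitz_like (\<lambda>p. epi (\<lambda>x. g (x, p))) pbar (xbar, real_of_ereal (g (xbar, pbar)))"
    and "\<tau> = coderivative_limit g xbar pbar vhat"
  shows "\<tau> > - \<infinity> \<and> prox_threshold g xbar pbar vhat = max 0 (- \<tau>)"
proof -
  have proper: "g (x, p) \<noteq> - \<infinity>" for x p using assms(1) by blast
  note lsc = assms(2)
  have vhat: "vhat \<in> partial_subdiff g xbar pbar" using assms(3,4) by auto
  have \<tau>: "\<tau> = coderivative_limit g xbar pbar vhat" by fact
  have cont: "continuous (at (xbar, pbar, vhat) within gph_partial_subdiff g) (\<lambda>(x, p, v). g (x, p))"
    using A2 by (simp add: param_cont_prox_regular_def)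
  note prox_iff = prox_regular_with_iff_prox_inequality[OF cont partial_subdiff_finite[OF vhat]]
  have lower: "ereal (- r) \<le> \<tau>" if r: "r > 0" "prox_regular_with g xbar pbar vhat r" for r
  proof -
    obtain \<rho> where \<rho>: "\<rho> > 0" "\<forall>p\<in>ball pbar \<rho>. prox_inequality_on (\<lambda>x. g (x, p)) xbar vhat r \<rho>"
      using r(2) unfolding prox_iff by blast
    obtain \<eta> where "\<eta> > 0" "ereal (- r) \<le> coderivative_bound g xbar pbar vhat \<eta>"
      using prox_inequality_imp_coderivative_bound[OF proper lsc vhat A3 \<rho>(2,1)] r(1) by (meson less_imp_le)
    then show ?thesis unfolding \<tau> using coderivative_limit_ge order_trans by blast
  qed
  obtain R where R: "R > 0" "prox_regular_with g xbar pbar vhat R"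
    using A2 by (auto simp: param_cont_prox_regular_def)
  then have fin: "\<tau> > - \<infinity>" using lower[OF R] by (cases \<tau>) auto
  have upper: "prox_regular_with g xbar pbar vhat r" if r: "max 0 (- \<tau>) < ereal r" for r
  proof -
    obtain r' where r': "max 0 (- \<tau>) < ereal r'" "ereal r' < ereal r" using ereal_dense2[OF r] by blast
    then have "ereal (- r') < coderivative_limit g xbar pbar vhat"
      unfolding \<tau>[symmetric] by (cases \<tau>) auto
    then obtain \<eta> where \<eta>: "\<eta> > 0" "ereal (- r') < coderivative_bound g xbar pbar vhat \<eta>"
      by (rule coderivative_limit_greaterD)
    obtain \<rho> where \<rho>: "\<rho> > 0" "\<forall>p\<in>ball pbar \<rho>. prox_inequality_on (\<lambda>x. g (x, p)) xbar vhat R \<rho>"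
      using R(2) unfolding prox_iff by blast
    show ?thesis
      unfolding prox_iff
      by (rule coderivative_bound_imp_prox_inequality[OF proper lsc vhat A3 \<rho>(2,1) _ \<eta>(1) less_imp_le[OF \<eta>(2)]])
        (use R r' in auto)
  qed
  have "prox_threshold g xbar pbar vhat = max 0 (- \<tau>)"
  proof (rule antisym)
    show "max 0 (- \<tau>) \<le> prox_threshold g xbar pbar vhat"
      unfolding prox_threshold_def
    proof (rule Inf_greatest)
      fix s assume "s \<in> {ereal r | r. r > 0 \<and> prox_regular_with g xbar pbar vhat r}"
      then obtain r where r: "s = ereal r" "r > 0" "prox_regular_with g xbar pbar vhat r" by blast
      show "max 0 (- \<tau>) \<le> s" using lower[OF r(2,3)] r(2) unfolding r(1) by (cases \<tau>) auto
    qed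
    show "prox_threshold g xbar pbar vhat \<le> max 0 (- \<tau>)"
    proof (rule dense_ge)
      fix s assume s: "max 0 (- \<tau>) < s"
      then obtain r where r: "max 0 (- \<tau>) < ereal r" "ereal r < s" using ereal_dense2 by blast
      have "prox_threshold g xbar pbar vhat \<le> ereal r"
        unfolding prox_threshold_def using upper[OF r(1)] r(1) by (intro Inf_lower) auto
      then show "prox_threshold g xbar pbar vhat \<le> s" using r(2) by simp
    qed
  qed
  then show ?thesis using fin by blast
qed

end
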